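(* Let $d\ge 2$ be an integer, let $A$ and $B$ be quantum systems with Hilbert spaces of dimension $d$ and non-degenerate (finite-energy) Hamiltonians $H_A,H_B$, and let $\gamma_A,\gamma_B$ be the thermal states of $H_A,H_B$ at (finite) temperatures $T_A,T_B$. Let $P_{\min}$ be the smallest eigenvalue among the eigenvalues of $\gamma_A$ and $\gamma_B$, and $\epsilon_*:=dP_{\min}$. Then for all $T_A,T_B>0$ the map $\mathcal{E}^{\epsilon_*}$ defined by $$\mathcal{E}^{\epsilon}(\rho)=(1-\epsilon)\,\eta_A^{\epsilon}\otimes\eta_B^{\epsilon}+\epsilon\,\mathcal{T}(\rho)\quad\text{for states }\rho,\qquad \eta_X^\epsilon=\gamma_X+\frac{\epsilon}{1-\epsilon}\Big(\gamma_X-\frac{\mathbb{I}_X}{d}\Big)\ (X=A,B),$$ taken at $\epsilon=\epsilon_*$, is an entanglement preserving local thermalization to $(\gamma_A,\gamma_B)$.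
   Context: A channel is a completely positive trace-preserving linear map. The thermal state of a Hamiltonian $H_X$ at temperature $T_X>0$ is $\gamma_X=e^{-H_X/kT_X}/\mathrm{tr}(e^{-H_X/kT_X})$, $k>0$ Boltzmann's constant. The orthonormal basis $\{|n\rangle\}_{n=0}^{d-1}$ of each local system is the energy eigenbasis ordered by increasing energy, so $\gamma_X=\sum_n P_n^X|n\rangle\langle n|$ with $P^X_0\ge\dots\ge P^X_{d-1}$; complex conjugation $U^*$ is taken in this basis. The twirling operation is $\mathcal{T}(\rho)=\int_{U(d)}(U\otimes U^* )\rho(U\otimes U^* )^\dagger dU$, with $dU$ the normalized Haar measure on the unitary group $U(d)$. The formula for $\mathcal{E}^\epsilon$ on states is extended linearly to all operators (the constant term being multiplied by the trace). A bipartite channel $\mathcal{E}$ on $AB$ is an LOSR channel (local operations and shared randomness) if $\mathcal{E}=\int(\mathcal{E}_A^\lambda\otimes\mathcal{E}_B^\lambda)p_\lambda d\lambda$ with $p_\lambda\ge0$, $\int p_\lambda d\lambda=1$ (a general probability distribution over $\lambda$), and $\mathcal{E}_A^\lambda,\mathcal{E}_B^\lambda$ channels on $A$, $B$. A channel $\mathcal{E}$ on $AB$ is a local thermalization to $(\gamma_A,\gamma_B)$ if (1) it is an LOSR channel, and (2) $\mathrm{tr}_A[\mathcal{E}(\rho_{AB})]=\gamma_B$ and $\mathrm{tr}_B[\mathcal{E}(\rho_{AB})]=\gamma_A$ for every state $\rho_{AB}$. It is an entanglement preserving local thermalization (EPLT) to $(\gamma_A,\gamma_B)$ if, furthermore,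 there is a state $\rho_{AB}$ such that $\mathcal{E}(\rho_{AB})$ is entangled (not separable). *)

theory Defs
  imports "HOL-Analysis.Analysis" "HOL-Probability.Probability_Measure"
begin

type_synonym 'a op = "((complex, 'a) vec, 'a) vec"

definition cscale :: "complex \<Rightarrow> complex^'n^'m \<Rightarrow> complex^'n^'m" where
  "cscale c = map_matrix (\<lambda>x. c * x)"

definition adj :: "complex^'n^'m \<Rightarrow> complex^'m^'n" where
  "adj A = map_matrix cnj (transpose A)"

definition cinner :: "complex^'n \<Rightarrow> complex^'n \<Rightarrow> complex" where
  "cinner u v = (\<Sum>i\<in>UNIV. cnj (u $ i) * v $ i)"

(* Over the complex numbers this entails that A is Hermitian. *)
definition psd :: "complex^'n^'n \<Rightarrow> bool" where
  "psd A \<longleftrightarrow> (\<forall>v. cinner v (A *v v) \<in> \<real>\<^sub>\<ge>\<^sub>0)"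

definition density_op :: "complex^'n^'n \<Rightarrow> bool" where
  "density_op \<rho> \<longleftrightarrow> psd \<rho> \<and> trace \<rho> = 1"

(* kron A B is the operator A \<otimes> B; the composite system is indexed by pairs. *)
definition kron :: "complex^'a::finite^'a \<Rightarrow> complex^'b::finite^'b \<Rightarrow> complex^('a \<times> 'b)^('a \<times> 'b)" where
  "kron A B = (\<chi> p q. A $ fst p $ fst q * B $ snd p $ snd q)"

(* ptrace_A traces out the first factor (leaving an operator on B), ptrace_B the second. *)
definition ptrace_A :: "complex^('a::finite \<times> 'b::finite)^('a \<times> 'b) \<Rightarrow> complex^'b^'b" where
  "ptrace_A X = (\<chi> k l. \<Sum>i\<in>UNIV. X $ (i, k) $ (i, l))"

definition ptrace_B :: "complex^('a::finite \<times> 'b::finite)^('a \<times> 'b) \<Rightarrow> complex^'a^'a" where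
  "ptrace_B X = (\<chi> i j. \<Sum>k\<in>UNIV. X $ (i, k) $ (j, k))"

definition separable :: "complex^('a::finite \<times> 'b::finite)^('a \<times> 'b) \<Rightarrow> bool" where
  "separable \<rho> \<longleftrightarrow> \<rho> \<in> convex hull {kron \<sigma> \<tau> | \<sigma> \<tau>. density_op \<sigma> \<and> density_op \<tau>}"


(* Positivity of a k-by-k block matrix whose blocks X i j are operators,
   i.e. of an element of M_k(C) \<otimes> L(C^n). *)
definition block_psd :: "nat \<Rightarrow> (nat \<Rightarrow> nat \<Rightarrow> complex^'n^'n) \<Rightarrow> bool" where
  "block_psd k X \<longleftrightarrow>
     (\<forall>v :: nat \<Rightarrow> complex^'n. (\<Sum>i<k. \<Sum>j<k. cinner (v i) (X i j *v v j)) \<in> \<real>\<^sub>\<ge>\<^sub>0)"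

(* For every k, id_k \<otimes> E is a positive map: it acts blockwise. *)
definition completely_positive :: "(complex^'n^'n \<Rightarrow> complex^'m^'m) \<Rightarrow> bool" where
  "completely_positive E \<longleftrightarrow>
     (\<forall>k X. block_psd k X \<longrightarrow> block_psd k (\<lambda>i j. E (X i j)))"

definition channel :: "(complex^'n^'n \<Rightarrow> complex^'m^'m) \<Rightarrow> bool" where
  "channel E \<longleftrightarrow> Vector_Spaces.linear cscale cscale E \<and> completely_positive E \<and>
     (\<forall>X. trace (E X) = trace X)"

definition mat_unit :: "'n \<Rightarrow> 'n \<Rightarrow> complex^'n^'n" where
  "mat_unit i j = (\<chi> p q. if p = i \<and> q = j then 1 else 0)"

(* E \<otimes> F, as the linear map with X \<otimes> Y \<mapsto> E X \<otimes> F Y on matrix units. *)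
definition map_tensor ::
  "('a op \<Rightarrow> 'a op) \<Rightarrow> ('b op \<Rightarrow> 'b op) \<Rightarrow>
   complex^('a::finite \<times> 'b::finite)^('a \<times> 'b) \<Rightarrow> complex^('a \<times> 'b)^('a \<times> 'b)" where
  "map_tensor E F X = (\<Sum>i\<in>UNIV. \<Sum>j\<in>UNIV. \<Sum>k\<in>UNIV. \<Sum>l\<in>UNIV.
     cscale (X $ (i, k) $ (j, l)) (kron (E (mat_unit i j)) (F (mat_unit k l))))"

definition losr_mixture ::
  "'l measure \<Rightarrow> ('l \<Rightarrow> 'a op \<Rightarrow> 'a op) \<Rightarrow> ('l \<Rightarrow> 'b op \<Rightarrow> 'b op) \<Rightarrow>
   (complex^('a::finite \<times> 'b::finite)^('a \<times> 'b) \<Rightarrow> complex^('a \<times> 'b)^('a \<times> 'b)) \<Rightarrow> bool" where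
  "losr_mixture M EA EB E \<longleftrightarrow> prob_space M \<and>
     (\<forall>l\<in>space M. channel (EA l) \<and> channel (EB l)) \<and>
     (\<forall>X. has_bochner_integral M (\<lambda>l. map_tensor (EA l) (EB l) X) (E X))"

(* HOL cannot quantify existentially over the type of the shared variable l.  Labelling by pairs of
   maps loses no generality: losr_channelI reduces an arbitrary label space to this one. *)
definition losr_channel ::
  "(complex^('a::finite \<times> 'b::finite)^('a \<times> 'b) \<Rightarrow> complex^('a \<times> 'b)^('a \<times> 'b)) \<Rightarrow> bool" where
  "losr_channel E \<longleftrightarrow> channel E \<and>
     (\<exists>(M :: (('a op \<Rightarrow> 'a op) \<times> ('b op \<Rightarrow> 'b op)) measure) EA EB. losr_mixture M EA EB E)"

definition local_thermalization ::
  "complex^'a::finite^'a \<Rightarrow> complex^'b::finite^'b \<Rightarrow>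
   (complex^('a \<times> 'b)^('a \<times> 'b) \<Rightarrow> complex^('a \<times> 'b)^('a \<times> 'b)) \<Rightarrow> bool" where
  "local_thermalization \<gamma>\<^sub>A \<gamma>\<^sub>B E \<longleftrightarrow> losr_channel E \<and>
     (\<forall>\<rho>. density_op \<rho> \<longrightarrow> ptrace_A (E \<rho>) = \<gamma>\<^sub>B \<and> ptrace_B (E \<rho>) = \<gamma>\<^sub>A)"

definition EPLT ::
  "complex^'a::finite^'a \<Rightarrow> complex^'b::finite^'b \<Rightarrow>
   (complex^('a \<times> 'b)^('a \<times> 'b) \<Rightarrow> complex^('a \<times> 'b)^('a \<times> 'b)) \<Rightarrow> bool" where
  "EPLT \<gamma>\<^sub>A \<gamma>\<^sub>B E \<longleftrightarrow> local_thermalization \<gamma>\<^sub>A \<gamma>\<^sub>B E \<and>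
     (\<exists>\<rho>. density_op \<rho> \<and> \<not> separable (E \<rho>))"


(* HOL-Analysis has no normed algebra of matrices under **, hence the explicit exponential series. *)
definition mat_exp :: "complex^'n^'n \<Rightarrow> complex^'n^'n" where
  "mat_exp A = (\<Sum>m. (1 / fact m) *\<^sub>R (((**) A) ^^ m) (mat 1))"

definition thermal_state :: "real \<Rightarrow> real \<Rightarrow> complex^'n^'n \<Rightarrow> complex^'n^'n" where
  "thermal_state k T H =
     (let G = mat_exp (- (1 / (k * T)) *\<^sub>R H) in cscale (1 / trace G) G)"

definition hermitian :: "complex^'n^'n \<Rightarrow> bool" where
  "hermitian H \<longleftrightarrow> adj H = H"

definition eigenvalues :: "complex^'n^'n \<Rightarrow> complex set" where
  "eigenvalues A = {e. \<exists>v. v \<noteq> 0 \<and> A *v v = e *s v}"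

definition nondegenerate :: "complex^'n^'n \<Rightarrow> bool" where
  "nondegenerate H \<longleftrightarrow>
     (\<forall>e u v. u \<noteq> 0 \<and> H *v u = e *s u \<and> H *v v = e *s v \<longrightarrow> (\<exists>c. v = c *s u))"

(* e n is the ket |n>; the energy levels are labelled by the linearly ordered type 'n, which
   has as many elements as the dimension, so an orthonormal family is a basis. *)
definition energy_eigenbasis ::
  "'n::{finite,linorder} op \<Rightarrow> ('n \<Rightarrow> (complex, 'n) vec) \<Rightarrow> bool" where
  "energy_eigenbasis H e \<longleftrightarrow>
     (\<forall>m n. cinner (e m) (e n) = (if m = n then 1 else 0)) \<and>
     (\<exists>E :: 'n \<Rightarrow> real. mono E \<and> (\<forall>n. H *v e n = of_real (E n) *s e n))"


definition unitary_group :: "(complex^'n^'n) set" where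
  "unitary_group = {U. U ** adj U = mat 1 \<and> adj U ** U = mat 1}"

definition normalized_haar :: "(complex^'n^'n) measure \<Rightarrow> bool" where
  "normalized_haar \<mu> \<longleftrightarrow> prob_space \<mu> \<and> sets \<mu> = sets (restrict_space borel unitary_group) \<and>
     (\<forall>V\<in>unitary_group. distr \<mu> \<mu> (\<lambda>U. V ** U) = \<mu>)"

(* The operator whose matrix in the orthonormal basis e is U:  \<Sum>m n. U_mn |e_m><e_n|. *)
definition op_of_matrix :: "('n::finite \<Rightarrow> complex^'n) \<Rightarrow> complex^'n^'n \<Rightarrow> complex^'n^'n" where
  "op_of_matrix e U =
     (\<chi> i j. \<Sum>m\<in>UNIV. \<Sum>n\<in>UNIV. U $ m $ n * (e m $ i * cnj (e n $ j)))"

definition twirl ::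
  "(complex^'n::finite^'n) measure \<Rightarrow> ('n \<Rightarrow> complex^'n) \<Rightarrow> ('n \<Rightarrow> complex^'n) \<Rightarrow>
   complex^('n \<times> 'n)^('n \<times> 'n) \<Rightarrow> complex^('n \<times> 'n)^('n \<times> 'n)" where
  "twirl \<mu> a b X = (\<integral>U. (let W = kron (op_of_matrix a U) (op_of_matrix b (map_matrix cnj U))
                          in W ** X ** adj W) \<partial>\<mu>)"

definition eta :: "real \<Rightarrow> complex^'n^'n \<Rightarrow> complex^'n^'n" where
  "eta \<epsilon> \<gamma> = \<gamma> + (\<epsilon> / (1 - \<epsilon>)) *\<^sub>R (\<gamma> - (1 / real CARD('n)) *\<^sub>R mat 1)"

definition thermalizing_map ::
  "(complex^'n::finite^'n) measure \<Rightarrow> ('n \<Rightarrow> complex^'n) \<Rightarrow> ('n \<Rightarrow> complex^'n) \<Rightarrow>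
   complex^'n^'n \<Rightarrow> complex^'n^'n \<Rightarrow> real \<Rightarrow>
   complex^('n \<times> 'n)^('n \<times> 'n) \<Rightarrow> complex^('n \<times> 'n)^('n \<times> 'n)" where
  "thermalizing_map \<mu> a b \<gamma>\<^sub>A \<gamma>\<^sub>B \<epsilon> X =
     cscale (trace X) ((1 - \<epsilon>) *\<^sub>R kron (eta \<epsilon> \<gamma>\<^sub>A) (eta \<epsilon> \<gamma>\<^sub>B)) + \<epsilon> *\<^sub>R twirl \<mu> a b X"


lemma vector_space_cscale: "vector_space (cscale :: complex \<Rightarrow> complex^'n^'m \<Rightarrow> _)"
  by unfold_locales (simp_all add: cscale_def map_matrix_def vec_eq_iff algebra_simps)

lemma losr_channelI:
  fixes E :: "complex^('a::finite \<times> 'b::finite)^('a \<times> 'b) \<Rightarrow> complex^('a \<times> 'b)^('a \<times> 'b)"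
    and M :: "'l measure"
  assumes "channel E" and mix: "losr_mixture M EA EB E"
  shows "losr_channel E"
proof -
  define f where "f = (\<lambda>l. (EA l, EB l))"
  define N where "N = sigma (f ` space M) {S. S \<subseteq> f ` space M \<and> f -` S \<inter> space M \<in> sets M}"
  have sp: "space N = f ` space M"
    unfolding N_def by (rule space_measure_of) auto
  have "sigma_algebra (f ` space M) {S. S \<subseteq> f ` space M \<and> f -` S \<inter> space M \<in> sets M}"
  proof (unfold sigma_algebra_iff2, intro conjI ballI allI impI)
    fix S assume "S \<in> {S. S \<subseteq> f ` space M \<and> f -` S \<inter> space M \<in> sets M}"
    then have "f -` S \<inter> space M \<in> sets M" by simp
    moreover have "f -` (f ` space M - S) \<inter> space M = space M - (f -` S \<inter> space M)" by auto
    ultimately show "f ` space M - S \<in> {S. S \<subseteq> f ` space M \<and> f -` S \<inter> space M \<in> sets M}"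
      by auto
  next
    fix S :: "nat \<Rightarrow> _"
    assume S: "range S \<subseteq> {S. S \<subseteq> f ` space M \<and> f -` S \<inter> space M \<in> sets M}"
    have "f -` (\<Union> (range S)) \<inter> space M = (\<Union>i. f -` S i \<inter> space M)" by auto
    also have "\<dots> \<in> sets M" using S by (intro sets.countable_UN) auto
    finally show "\<Union> (range S) \<in> {S. S \<subseteq> f ` space M \<and> f -` S \<inter> space M \<in> sets M}"
      using S by blast
  qed auto
  then have st: "sets N = {S. S \<subseteq> f ` space M \<and> f -` S \<inter> space M \<in> sets M}"
    unfolding N_def by (subst sigma_algebra.sets_measure_of_eq) auto
  have f[measurable]: "f \<in> measurable M N"
    by (rule measurableI) (auto simp: sp st)
  have meas: "g \<in> borel_measurable N" if "(\<lambda>l. g (f l)) \<in> borel_measurable M"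
    for g :: "_ \<Rightarrow> complex^('a \<times> 'b)^('a \<times> 'b)"
  proof (rule measurableI)
    fix S :: "(complex^('a \<times> 'b)^('a \<times> 'b)) set" assume "S \<in> sets borel"
    then have "(\<lambda>l. g (f l)) -` S \<inter> space M \<in> sets M"
      by (rule measurable_sets[OF that])
    moreover have "(\<lambda>l. g (f l)) -` S \<inter> space M = f -` (g -` S \<inter> space N) \<inter> space M"
      by (auto simp: sp)
    ultimately show "g -` S \<inter> space N \<in> sets N" by (auto simp: st sp)
  qed auto
  have "losr_mixture (distr M N f) fst snd E"
    unfolding losr_mixture_def
  proof (intro conjI allI ballI)
    show "prob_space (distr M N f)"
      using mix by (intro prob_space.prob_space_distr) (auto simp: losr_mixture_def f)
    fix X
    have "has_bochner_integral M (\<lambda>l. map_tensor (fst (f l)) (snd (f l)) X) (E X)"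
      using mix by (simp add: losr_mixture_def f_def)
    moreover from this
    have "(\<lambda>p. map_tensor (fst p) (snd p) X) \<in> borel_measurable N"
      by (intro meas) (rule borel_measurable_has_bochner_integral)
    ultimately show
      "has_bochner_integral (distr M N f) (\<lambda>p. map_tensor (fst p) (snd p) X) (E X)"
      using f by (simp add: has_bochner_integral_iff integrable_distr_eq integral_distr)
  qed (use mix in \<open>auto simp: losr_mixture_def sp f_def\<close>)
  then show ?thesis
    using assms(1) unfolding losr_channel_def by blast
qed

end

theory Submission
  imports Defs "HOL-Probability.Probability_Mass_Function" "HOL-Combinatorics.Transposition"
begin

text \<open>
  Write \<open>\<eta>\<^sub>X = (\<gamma>\<^sub>X - P\<^sub>m\<^sub>i\<^sub>n) / (1 - \<epsilon>)\<close>. Non-degeneracy makes the Gibbs weights pairwise distinct, so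
  \<open>0 < P\<^sub>m\<^sub>i\<^sub>n < 1/d\<close> and both \<open>\<eta>\<^sub>X\<close> are states. With probability \<open>1 - \<epsilon>\<close> the two parties replace
  their systems by \<open>\<eta>\<^sub>A\<close>, \<open>\<eta>\<^sub>B\<close>; otherwise they apply \<open>U\<close>, \<open>U\<^sup>*\<close> for a shared Haar-random \<open>U\<close>. The marginals
  of a twirled state commute with every unitary, hence are maximally mixed.

  The twirl fixes the maximally entangled state \<open>\<Phi>\<close>. By the choice of \<open>\<epsilon>\<close>, one of \<open>\<eta>\<^sub>A\<close>, \<open>\<eta>\<^sub>B\<close> annihilates
  some basis vector \<open>j\<close>. For \<open>i \<noteq> j\<close> the output state on \<open>\<Phi>\<close> therefore has a vanishing diagonal entry at
  \<open>a\<^sub>i \<otimes> b\<^sub>j\<close> or at \<open>a\<^sub>j \<otimes> b\<^sub>i\<close>, while the entry between \<open>a\<^sub>i \<otimes> b\<^sub>i\<close> and \<open>a\<^sub>j \<otimes> b\<^sub>j\<close> is \<open>\<epsilon>/d > 0\<close>: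
  its partial transpose is not positive.
\<close>

section \<open>Matrix algebra\<close>

lemma sum_UNIV_prod:
  fixes f :: "'a::finite \<times> 'b::finite \<Rightarrow> 'c::comm_monoid_add"
  shows "(\<Sum>p\<in>UNIV. f p) = (\<Sum>i\<in>UNIV. \<Sum>k\<in>UNIV. f (i, k))"
  by (simp add: sum.cartesian_product flip: UNIV_Times_UNIV)

text \<open>Carries the summation of a partial trace past the four sums of a conjugation, so that it
  meets the two factors to which the isometry relation applies.\<close>

lemma sum_move_inward:
  fixes f :: "'a \<Rightarrow> 'b \<Rightarrow> 'c \<Rightarrow> 'd \<Rightarrow> 'e \<Rightarrow> 'f::comm_monoid_add"
  shows "(\<Sum>m\<in>A. \<Sum>p\<in>B. \<Sum>p'\<in>C. \<Sum>q\<in>D. \<Sum>q'\<in>E. f m p p' q q') =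
    (\<Sum>p\<in>B. \<Sum>p'\<in>C. \<Sum>q\<in>D. \<Sum>q'\<in>E. \<Sum>m\<in>A. f m p p' q q')"
  by (rule trans[OF sum.swap], rule sum.cong[OF refl], rule trans[OF sum.swap], rule sum.cong[OF refl],
      rule trans[OF sum.swap], rule sum.cong[OF refl], rule sum.swap)

lemma adj_nth [simp]: "adj A $ i $ j = cnj (A $ j $ i)"
  by (simp add: adj_def map_matrix_def transpose_def)

lemma cscale_nth [simp]: "cscale c A $ i $ j = c * A $ i $ j"
  by (simp add: cscale_def map_matrix_def)

lemma kron_nth [simp]: "kron A B $ p $ q = A $ fst p $ fst q * B $ snd p $ snd q"
  by (simp add: kron_def)

lemma mat_nth: "mat c $ i $ j = (if i = j then c else 0)"
  by (simp add: mat_def)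

lemma matrix_mult_nth: "(A ** B) $ i $ j = (\<Sum>k\<in>UNIV. A $ i $ k * B $ k $ j)"
  by (simp add: matrix_matrix_mult_def)

lemma matrix_vector_nth: "(A *v v) $ i = (\<Sum>k\<in>UNIV. A $ i $ k * v $ k)"
  by (simp add: matrix_vector_mult_def)

lemma adj_adj [simp]: "adj (adj A) = A"
  by (simp add: vec_eq_iff)

lemma adj_mult: "adj (A ** B) = adj B ** adj A"
  by (simp add: vec_eq_iff matrix_mult_nth mult.commute)

lemma adj_kron: "adj (kron A B) = kron (adj A) (adj B)"
  by (simp add: vec_eq_iff)

lemma kron_mult: "kron A B ** kron C D = kron (A ** C) (B ** D)"
  by (simp add: vec_eq_iff matrix_mult_nth sum_UNIV_prod sum_product mult_ac)

lemma kron_mat_1 [simp]: "kron (mat 1) (mat 1) = mat 1"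
  by (auto simp: vec_eq_iff mat_nth prod_eq_iff)

lemma trace_cscale [simp]: "trace (cscale c A) = c * trace A"
  by (simp add: trace_def sum_distrib_left)

lemma trace_kron: "trace (kron A B) = trace A * trace B"
  by (simp add: trace_def sum_UNIV_prod sum_product)

lemma trace_scaleR: "trace (r *\<^sub>R (A :: complex^'n^'n)) = of_real r * trace A"
  by (simp add: trace_def sum_distrib_left) (simp add: scaleR_conv_of_real)

text \<open>The completely positive map with the single Kraus operator \<open>V\<close>. Replacement
  channels are sums of such maps, and the twirl is an average of them.\<close>

definition conj_by :: "complex^'n^'m \<Rightarrow> complex^'n^'n \<Rightarrow> complex^'m^'m" where
  "conj_by V X = V ** X ** adj V"

lemma conj_by_nth:
  "conj_by V X $ i $ j = (\<Sum>p\<in>UNIV. \<Sum>q\<in>UNIV. V $ i $ p * X $ p $ q * cnj (V $ j $ q))"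
  by (simp add: conj_by_def matrix_mult_nth sum_distrib_right) (rule sum.swap)

text \<open>With at most one nonzero entry per row, only one term of the double sum survives. This
  covers both the Kraus operators of a replacement channel and the sign changes and permutations in
  Schur's lemma.\<close>

lemma conj_by_monomial:
  "conj_by (\<chi> i p. if p = f i then c i else 0) X $ i $ j = c i * X $ f i $ f j * cnj (c j)"
proof -
  have "conj_by (\<chi> i p. if p = f i then c i else 0) X $ i $ j =
      (\<Sum>p\<in>UNIV. \<Sum>q\<in>UNIV. if p = f i then if q = f j then c i * X $ p $ q * cnj (c j) else 0 else 0)"
    unfolding conj_by_nth by (intro sum.cong refl) auto
  also have "\<dots> = (\<Sum>p\<in>UNIV. if p = f i then
      \<Sum>q\<in>UNIV. if q = f j then c i * X $ p $ q * cnj (c j) else 0 else 0)"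
    by (intro sum.cong refl) auto
  finally show ?thesis by simp
qed

lemma conj_by_conj_by: "conj_by V (conj_by W X) = conj_by (V ** W) X"
  by (simp add: conj_by_def adj_mult matrix_mul_assoc)

lemma trace_conj_by:
  assumes "adj V ** V = mat 1"
  shows "trace (conj_by V X) = trace X"
  using assms by (metis conj_by_def matrix_mul_assoc matrix_mul_lid trace_mul_sym)

lemma conj_by_add: "conj_by V (X + Y) = conj_by V X + conj_by V Y"
  by (simp add: vec_eq_iff conj_by_nth algebra_simps sum.distrib)

lemma conj_by_cscale: "conj_by V (cscale c X) = cscale c (conj_by V X)"
  by (simp add: vec_eq_iff conj_by_nth sum_distrib_left algebra_simps)

lemma conj_by_scaleR: "conj_by V (r *\<^sub>R X) = r *\<^sub>R conj_by V X"
  by (simp add: vec_eq_iff conj_by_nth scaleR_sum_right algebra_simps)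

lemma bounded_linear_conj_by: "bounded_linear (conj_by V :: complex^'n^'n \<Rightarrow> complex^'m^'m)"
  by (intro linear_conv_bounded_linear[THEN iffD1] linearI conj_by_add conj_by_scaleR)

section \<open>Partial traces of sums, products and conjugated operators\<close>

lemma ptrace_A_add: "ptrace_A (X + Y) = ptrace_A X + ptrace_A Y"
  by (simp add: vec_eq_iff ptrace_A_def sum.distrib)

lemma ptrace_B_add: "ptrace_B (X + Y) = ptrace_B X + ptrace_B Y"
  by (simp add: vec_eq_iff ptrace_B_def sum.distrib)

lemma ptrace_A_scaleR: "ptrace_A (r *\<^sub>R X) = r *\<^sub>R ptrace_A X"
  by (simp add: vec_eq_iff ptrace_A_def scaleR_sum_right)

lemma ptrace_B_scaleR: "ptrace_B (r *\<^sub>R X) = r *\<^sub>R ptrace_B X"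
  by (simp add: vec_eq_iff ptrace_B_def scaleR_sum_right)

lemma ptrace_A_kron: "ptrace_A (kron A B) = cscale (trace A) B"
  by (simp add: vec_eq_iff ptrace_A_def trace_def sum_distrib_right)

lemma ptrace_B_kron: "ptrace_B (kron A B) = cscale (trace B) A"
  by (simp add: vec_eq_iff ptrace_B_def trace_def sum_distrib_left mult.commute)

lemma trace_ptrace_A: "trace (ptrace_A X) = trace X"
  by (simp add: ptrace_A_def trace_def sum_UNIV_prod) (rule sum.swap)

lemma trace_ptrace_B: "trace (ptrace_B X) = trace X"
  by (simp add: ptrace_B_def trace_def sum_UNIV_prod)

lemma isometry_nth:
  assumes "adj W ** W = mat 1"
  shows "(\<Sum>k\<in>UNIV. W $ k $ p * cnj (W $ k $ q)) = (if p = q then 1 else 0)"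
proof -
  have "(adj W ** W) $ q $ p = mat 1 $ q $ p"
    using assms by simp
  then show ?thesis
    by (auto simp: matrix_mult_nth mat_nth mult.commute)
qed

text \<open>An isometry on the factor that is traced out cancels by cyclicity of the trace. In
  coordinates, the sum over the traced index \<open>m\<close> is an inner product of two columns of
  \<open>W\<close>, which are orthonormal.\<close>

lemma ptrace_B_conj_by:
  assumes "adj W ** W = mat 1"
  shows "ptrace_B (conj_by (kron V W) X) = conj_by V (ptrace_B X)"
proof -
  have "ptrace_B (conj_by (kron V W) X) $ i $ j = conj_by V (ptrace_B X) $ i $ j" for i j
  proof -
    have "ptrace_B (conj_by (kron V W) X) $ i $ j =
        (\<Sum>m\<in>UNIV. \<Sum>p\<in>UNIV. \<Sum>p'\<in>UNIV. \<Sum>q\<in>UNIV. \<Sum>q'\<in>UNIV.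
          V $ i $ p * X $ (p, p') $ (q, q') * cnj (V $ j $ q) * (W $ m $ p' * cnj (W $ m $ q')))"
      by (simp add: ptrace_B_def conj_by_nth sum_UNIV_prod mult_ac)
    also have "\<dots> = (\<Sum>p\<in>UNIV. \<Sum>p'\<in>UNIV. \<Sum>q\<in>UNIV. \<Sum>q'\<in>UNIV. \<Sum>m\<in>UNIV.
          V $ i $ p * X $ (p, p') $ (q, q') * cnj (V $ j $ q) * (W $ m $ p' * cnj (W $ m $ q')))"
      by (rule sum_move_inward)
    also have "\<dots> = (\<Sum>p\<in>UNIV. \<Sum>p'\<in>UNIV. \<Sum>q\<in>UNIV.
          V $ i $ p * X $ (p, p') $ (q, p') * cnj (V $ j $ q))"
      by (simp add: isometry_nth[OF assms] flip: sum_distrib_left) (simp add: if_distrib cong: if_cong)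
    also have "\<dots> = (\<Sum>p\<in>UNIV. \<Sum>q\<in>UNIV. \<Sum>p'\<in>UNIV.
          V $ i $ p * X $ (p, p') $ (q, p') * cnj (V $ j $ q))"
      by (rule sum.cong[OF refl], rule sum.swap)
    also have "\<dots> = conj_by V (ptrace_B X) $ i $ j"
      by (simp add: ptrace_B_def conj_by_nth sum_distrib_left sum_distrib_right)
    finally show ?thesis .
  qed
  then show ?thesis by (simp add: vec_eq_iff)
qed

lemma ptrace_A_conj_by:
  assumes "adj V ** V = mat 1"
  shows "ptrace_A (conj_by (kron V W) X) = conj_by W (ptrace_A X)"
proof -
  have "ptrace_A (conj_by (kron V W) X) $ i $ j = conj_by W (ptrace_A X) $ i $ j" for i j
  proof -
    have "ptrace_A (conj_by (kron V W) X) $ i $ j =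
        (\<Sum>m\<in>UNIV. \<Sum>p\<in>UNIV. \<Sum>p'\<in>UNIV. \<Sum>q\<in>UNIV. \<Sum>q'\<in>UNIV.
          W $ i $ p' * X $ (p, p') $ (q, q') * cnj (W $ j $ q') * (V $ m $ p * cnj (V $ m $ q)))"
      by (simp add: ptrace_A_def conj_by_nth sum_UNIV_prod mult_ac)
    also have "\<dots> = (\<Sum>p\<in>UNIV. \<Sum>p'\<in>UNIV. \<Sum>q\<in>UNIV. \<Sum>q'\<in>UNIV. \<Sum>m\<in>UNIV.
          W $ i $ p' * X $ (p, p') $ (q, q') * cnj (W $ j $ q') * (V $ m $ p * cnj (V $ m $ q)))"
      by (rule sum_move_inward)
    also have "\<dots> = (\<Sum>p\<in>UNIV. \<Sum>p'\<in>UNIV. \<Sum>q'\<in>UNIV. \<Sum>q\<in>UNIV.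
          W $ i $ p' * X $ (p, p') $ (q, q') * cnj (W $ j $ q') * (if p = q then 1 else 0))"
      by (simp only: isometry_nth[OF assms] flip: sum_distrib_left)
         (rule sum.cong[OF refl], rule sum.cong[OF refl], rule sum.swap)
    also have "\<dots> = (\<Sum>p\<in>UNIV. \<Sum>p'\<in>UNIV. \<Sum>q'\<in>UNIV.
          W $ i $ p' * X $ (p, p') $ (p, q') * cnj (W $ j $ q'))"
      by (simp add: if_distrib cong: if_cong)
    also have "\<dots> = (\<Sum>p'\<in>UNIV. \<Sum>q'\<in>UNIV. \<Sum>p\<in>UNIV.
          W $ i $ p' * X $ (p, p') $ (p, q') * cnj (W $ j $ q'))"
      by (rule trans[OF sum.swap], rule sum.cong[OF refl], rule sum.swap)
    also have "\<dots> = conj_by W (ptrace_A X) $ i $ j"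
      by (simp add: ptrace_A_def conj_by_nth sum_distrib_left sum_distrib_right)
    finally show ?thesis .
  qed
  then show ?thesis by (simp add: vec_eq_iff)
qed

section \<open>The inner product and rank-one operators\<close>

lemma cinner_add_right: "cinner u (v + w) = cinner u v + cinner u w"
  by (simp add: cinner_def algebra_simps sum.distrib)

lemma cinner_add_left: "cinner (u + v) w = cinner u w + cinner v w"
  by (simp add: cinner_def algebra_simps sum.distrib)

lemma cinner_scale_right: "cinner u (c *s v) = c * cinner u v"
  by (simp add: cinner_def sum_distrib_left algebra_simps)

lemma cinner_scale_left: "cinner (c *s u) v = cnj c * cinner u v"
  by (simp add: cinner_def sum_distrib_left algebra_simps)

lemma cinner_sum_right: "cinner u (\<Sum>i\<in>I. f i) = (\<Sum>i\<in>I. cinner u (f i))"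
  by (simp add: cinner_def sum_distrib_left) (rule sum.swap)

lemma cinner_sum_left: "cinner (\<Sum>i\<in>I. f i) u = (\<Sum>i\<in>I. cinner (f i) u)"
  by (simp add: cinner_def sum_distrib_right) (rule sum.swap)

lemma cnj_cinner: "cnj (cinner u v) = cinner v u"
  by (simp add: cinner_def mult.commute)

lemma cinner_matrix: "cinner u (A *v v) = cinner (adj A *v u) v"
  by (simp add: cinner_def matrix_vector_nth sum_distrib_left sum_distrib_right mult_ac)
     (rule sum.swap)

lemma cinner_conj_by: "cinner u (conj_by V X *v v) = cinner (adj V *v u) (X *v (adj V *v v))"
  by (simp add: conj_by_def cinner_matrix adj_mult matrix_vector_mul_assoc[symmetric])

lemma matrix_sum_vector_mult:
  fixes A :: "'i \<Rightarrow> complex^'n^'m"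
  shows "(\<Sum>i\<in>I. A i) *v v = (\<Sum>i\<in>I. A i *v v)"
  by (simp add: vec_eq_iff matrix_vector_nth sum_distrib_right) (intro allI sum.swap)

lemma matrix_scaleR_vector_mult: "(r *\<^sub>R (A :: complex^'n^'m)) *v v = of_real r *s (A *v v)"
  by (simp add: vec_eq_iff matrix_vector_nth sum_distrib_left) (simp add: scaleR_conv_of_real mult_ac)

definition outer :: "complex^'n \<Rightarrow> complex^'n^'n" where
  "outer u = (\<chi> i j. u $ i * cnj (u $ j))"

lemma outer_mult_vec: "outer u *v v = cinner u v *s u"
  by (simp add: vec_eq_iff outer_def matrix_vector_nth cinner_def sum_distrib_left mult_ac)

lemma trace_outer: "trace (outer u) = cinner u u"
  by (simp add: trace_def outer_def cinner_def mult.commute)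

lemma conj_by_outer: "conj_by V (outer u) = outer (V *v u)"
  by (simp add: vec_eq_iff conj_by_nth outer_def matrix_vector_nth sum_product mult_ac)

definition vkron :: "complex^'a \<Rightarrow> complex^'b \<Rightarrow> complex^('a::finite \<times> 'b::finite)" where
  "vkron u v = (\<chi> p. u $ fst p * v $ snd p)"

lemma kron_vkron: "kron A B *v vkron u v = vkron (A *v u) (B *v v)"
  by (simp add: vec_eq_iff vkron_def matrix_vector_nth sum_UNIV_prod sum_product mult_ac)

lemma cinner_vkron: "cinner (vkron u v) (vkron u' v') = cinner u u' * cinner v v'"
  by (simp add: vkron_def cinner_def sum_UNIV_prod sum_product mult_ac)

lemma vkron_sum_left: "vkron (\<Sum>i\<in>I. f i) v = (\<Sum>i\<in>I. vkron (f i) v)"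
  by (simp add: vec_eq_iff vkron_def sum_distrib_right)

lemma vkron_sum_right: "vkron v (\<Sum>i\<in>I. f i) = (\<Sum>i\<in>I. vkron v (f i))"
  by (simp add: vec_eq_iff vkron_def sum_distrib_left)

lemma vkron_scale: "vkron (c *s u) (d *s v) = (c * d) *s vkron u v"
  by (simp add: vec_eq_iff vkron_def mult_ac)


section \<open>Spectral decompositions and thermal states\<close>

definition orthonormal :: "('n \<Rightarrow> complex^'n) \<Rightarrow> bool" where
  "orthonormal e \<longleftrightarrow> (\<forall>m n. cinner (e m) (e n) = (if m = n then 1 else 0))"

lemma orthonormalD: "orthonormal e \<Longrightarrow> cinner (e m) (e n) = (if m = n then 1 else 0)"
  by (simp add: orthonormal_def)

definition basis_matrix :: "('n \<Rightarrow> complex^'n) \<Rightarrow> complex^'n^'n" where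
  "basis_matrix e = (\<chi> i m. e m $ i)"

text \<open>The weights form a vector rather than a function, so that \<open>spectral e\<close> is a
  bounded linear map and the exponential series can be summed coordinatewise.\<close>

definition spectral :: "('n::finite \<Rightarrow> complex^'n) \<Rightarrow> real^'n \<Rightarrow> complex^'n^'n" where
  "spectral e x = (\<Sum>n\<in>UNIV. x $ n *\<^sub>R outer (e n))"

lemma unitary_groupI: "adj U ** U = mat 1 \<Longrightarrow> U \<in> unitary_group"
  using matrix_left_right_inverse by (auto simp: unitary_group_def)

lemma basis_matrix_unitary:
  assumes "orthonormal e"
  shows "basis_matrix e \<in> unitary_group"
  using assms by (intro unitary_groupI)
    (auto simp: vec_eq_iff matrix_mult_nth mat_nth basis_matrix_def orthonormal_def cinner_def)

lemma op_of_matrix_eq: "op_of_matrix e U = basis_matrix e ** U ** adj (basis_matrix e)"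
  by (simp add: vec_eq_iff op_of_matrix_def matrix_mult_nth basis_matrix_def sum_distrib_left mult_ac)
     (intro allI sum.swap)

lemma op_of_matrix_mult_vec:
  assumes "orthonormal e"
  shows "op_of_matrix e U *v e n = (\<Sum>m\<in>UNIV. U $ m $ n *s e m)"
proof -
  have "(op_of_matrix e U *v e n) $ i = (\<Sum>m\<in>UNIV. U $ m $ n *s e m) $ i" for i
  proof -
    have "(op_of_matrix e U *v e n) $ i =
        (\<Sum>m\<in>UNIV. \<Sum>l\<in>UNIV. U $ m $ l * e m $ i * cinner (e l) (e n))"
      by (simp add: op_of_matrix_def matrix_vector_nth cinner_def sum_distrib_right sum_distrib_left mult_ac)
         (rule trans[OF sum.swap], rule sum.cong[OF refl], rule sum.swap)
    also have "\<dots> = (\<Sum>m\<in>UNIV. U $ m $ n *s e m) $ i"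
      by (simp add: orthonormalD[OF assms] if_distrib cong: if_cong)
    finally show ?thesis .
  qed
  then show ?thesis by (simp add: vec_eq_iff)
qed

text \<open>The basis vectors are the columns of \<open>basis_matrix e\<close>, a unitary that can
  be cancelled on the right.\<close>

lemma matrix_eq_on_basis:
  assumes e: "orthonormal e" and "\<And>n. A *v e n = B *v e n"
  shows "A = B"
proof -
  have "A ** basis_matrix e = B ** basis_matrix e"
    using assms(2) by (simp add: vec_eq_iff matrix_mult_nth basis_matrix_def matrix_vector_nth)
  then have "A ** (basis_matrix e ** adj (basis_matrix e)) = B ** (basis_matrix e ** adj (basis_matrix e))"
    by (simp add: matrix_mul_assoc)
  then show ?thesis
    using basis_matrix_unitary[OF e] by (simp add: unitary_group_def)
qed

lemma spectral_mult_vec: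
  assumes "orthonormal e"
  shows "spectral e x *v e n = of_real (x $ n) *s e n"
proof -
  have "spectral e x *v e n = (\<Sum>m\<in>UNIV. of_real (x $ m) *s (outer (e m) *v e n))"
    by (simp add: spectral_def matrix_sum_vector_mult matrix_scaleR_vector_mult)
  also have "\<dots> = of_real (x $ n) *s e n"
    by (simp add: outer_mult_vec orthonormalD[OF assms] vec_eq_iff if_distrib if_distribR cong: if_cong)
  finally show ?thesis .
qed

lemma spectral_eqI:
  assumes "orthonormal e" "\<And>n. A *v e n = of_real (x $ n) *s e n"
  shows "A = spectral e x"
  using assms by (intro matrix_eq_on_basis[OF assms(1)]) (simp add: spectral_mult_vec)

lemma spectral_mult:
  assumes "orthonormal e"
  shows "spectral e x ** spectral e y = spectral e (\<chi> n. x $ n * y $ n)"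
  using assms by (intro spectral_eqI)
    (simp_all add: matrix_vector_mul_assoc[symmetric] spectral_mult_vec vec.scale vector_smult_assoc mult_ac)

lemma spectral_1:
  assumes "orthonormal e"
  shows "spectral e (\<chi> n. 1) = mat 1"
  using assms by (intro spectral_eqI[symmetric]) simp_all

lemma adj_spectral: "adj (spectral e x) = spectral e x"
  by (simp add: vec_eq_iff spectral_def outer_def mult_ac)

lemma trace_spectral:
  assumes "orthonormal e"
  shows "trace (spectral e x) = of_real (\<Sum>n\<in>UNIV. x $ n)"
proof -
  have "trace (spectral e x) = (\<Sum>n\<in>UNIV. of_real (x $ n) * trace (outer (e n)))"
    by (simp add: trace_def spectral_def sum_distrib_left)
       (rule trans[OF sum.swap], simp add: scaleR_conv_of_real)
  then show ?thesis
    using assms by (simp add: trace_outer orthonormal_def)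
qed

lemma bounded_linear_spectral: "bounded_linear (spectral e)"
  unfolding linear_conv_bounded_linear[symmetric]
  by (rule linearI) (simp_all add: spectral_def scaleR_add_left sum.distrib scaleR_sum_right)

lemma spectral_scaleR: "spectral e (c *\<^sub>R x) = c *\<^sub>R spectral e x"
  by (simp add: spectral_def scaleR_sum_right)

lemma eigenvector_nonzero:
  assumes "orthonormal e"
  shows "e n \<noteq> 0"
proof
  assume "e n = 0"
  then have "cinner (e n) (e n) = 0" by (simp add: cinner_def)
  with assms show False by (simp add: orthonormal_def)
qed

lemma eigenvalues_spectral:
  assumes e: "orthonormal e"
  shows "eigenvalues (spectral e x) = of_real ` range (($) x)"
proof (intro set_eqI iffI)
  fix z assume "z \<in> eigenvalues (spectral e x)"
  then obtain v where v: "v \<noteq> 0" "spectral e x *v v = z *s v"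
    by (auto simp: eigenvalues_def)
  \<comment> \<open>The coordinates of \<open>v\<close> in the basis are the entries of
    \<open>adj (basis_matrix e) *v v\<close>. If all of them vanished, unitarity would give
    \<open>v = 0\<close>.\<close>
  have "\<exists>n. cinner (e n) v \<noteq> 0"
  proof (rule ccontr)
    assume "\<not> ?thesis"
    then have "adj (basis_matrix e) *v v = 0"
      by (simp add: vec_eq_iff matrix_vector_nth basis_matrix_def cinner_def)
    then have "(basis_matrix e ** adj (basis_matrix e)) *v v = 0"
      by (simp add: matrix_vector_mul_assoc[symmetric])
    with v basis_matrix_unitary[OF e] show False
      by (simp add: unitary_group_def)
  qed
  then obtain n where n: "cinner (e n) v \<noteq> 0" by blast
  \<comment> \<open>Moving the self-adjoint operator to the other side of the inner product compares
    \<open>z\<close> with \<open>x $ n\<close> on a nonzero coordinate.\<close>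
  have "z * cinner (e n) v = cinner (e n) (spectral e x *v v)"
    by (simp add: v cinner_scale_right)
  also have "\<dots> = of_real (x $ n) * cinner (e n) v"
    by (simp add: cinner_matrix adj_spectral spectral_mult_vec[OF e] cinner_scale_left)
  finally show "z \<in> of_real ` range (($) x)"
    using n by auto
next
  fix z assume "z \<in> complex_of_real ` range (($) x)"
  then show "z \<in> eigenvalues (spectral e x)"
    using spectral_mult_vec[OF e] eigenvector_nonzero[OF e] by (auto simp: eigenvalues_def)
qed

text \<open>Powers act on the weights alone, so the operator series is the image of the
  coordinatewise real exponential series under the continuous linear map
  \<open>spectral e\<close>.\<close>

lemma mat_exp_spectral:
  assumes e: "orthonormal e"
  shows "mat_exp (spectral e x) = spectral e (\<chi> n. exp (x $ n))"
proof -
  have pow: "((**) (spectral e x) ^^ m) (mat 1) = spectral e (\<chi> n. x $ n ^ m)" for m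
    by (induction m) (simp_all add: spectral_1[OF e] spectral_mult[OF e])
  have "(\<lambda>m. \<chi> n. x $ n ^ m /\<^sub>R fact m) sums (\<chi> n. exp (x $ n))"
    unfolding sums_def by (rule vec_tendstoI) (use exp_converges[where 'a = real] in \<open>simp add: sums_def\<close>)
  then have "(\<lambda>m. spectral e (\<chi> n. x $ n ^ m /\<^sub>R fact m)) sums spectral e (\<chi> n. exp (x $ n))"
    by (rule bounded_linear.sums[OF bounded_linear_spectral])
  moreover have "spectral e (\<chi> n. x $ n ^ m /\<^sub>R fact m) =
      (1 / fact m) *\<^sub>R ((**) (spectral e x) ^^ m) (mat 1)" for m
    by (simp add: pow divide_inverse flip: spectral_scaleR) (rule arg_cong[of _ _ "spectral e"], simp add: vec_eq_iff)
  ultimately show ?thesis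
    unfolding mat_exp_def by (intro sums_unique[symmetric]) simp
qed

lemma thermal_state_spectral:
  fixes H :: "'n::{finite,linorder} op"
  assumes e: "energy_eigenbasis H e" and "nondegenerate H" and "k * T > 0"
  obtains p :: "(real, 'n) vec" where "thermal_state k T H = spectral e p" "orthonormal e"
    "\<And>n. p $ n > 0" "(\<Sum>n\<in>UNIV. p $ n) = 1" "inj (($) p)"
proof -
  from e obtain E where o: "orthonormal e" and E: "\<And>n. H *v e n = of_real (E n) *s e n"
    by (auto simp: energy_eigenbasis_def orthonormal_def)
  define w where "w = (\<chi> n. exp (- E n / (k * T)))"
  define Z where "Z = (\<Sum>n\<in>UNIV. w $ n)"
  have Z: "Z > 0"
    unfolding Z_def by (rule sum_pos) (auto simp: w_def)
  have "(- (1 / (k * T))) *\<^sub>R H = spectral e (\<chi> n. - E n / (k * T))"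
    using spectral_eqI[OF o, of H "\<chi> n. E n"] E
    by (simp flip: spectral_scaleR) (rule arg_cong[of _ _ "spectral e"], simp add: vec_eq_iff)
  then have G: "mat_exp (- (1 / (k * T)) *\<^sub>R H) = spectral e w"
    by (simp add: mat_exp_spectral[OF o] w_def)
  show ?thesis
  proof
    show "thermal_state k T H = spectral e ((1 / Z) *\<^sub>R w)"
      unfolding thermal_state_def G Let_def trace_spectral[OF o] spectral_scaleR Z_def[symmetric]
      by (simp add: vec_eq_iff) (simp add: scaleR_conv_of_real)
    show "orthonormal e" by fact
    show "((1 / Z) *\<^sub>R w) $ n > 0" for n
      using Z by (simp add: w_def)
    show "(\<Sum>n\<in>UNIV. ((1 / Z) *\<^sub>R w) $ n) = 1"
      using Z by (simp add: Z_def flip: sum_divide_distrib)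
    \<comment> \<open>Non-degeneracy enters here: equal energies would make \<open>e n\<close> a
      multiple of the orthogonal vector \<open>e m\<close>, hence zero.\<close>
    have "E m \<noteq> E n" if "m \<noteq> n" for m n
    proof
      assume "E m = E n"
      then have "\<exists>c. e n = c *s e m"
        using \<open>nondegenerate H\<close> E eigenvector_nonzero[OF o] unfolding nondegenerate_def by metis
      then obtain c where c: "e n = c *s e m" by blast
      have "cinner (e m) (e n) = c * cinner (e m) (e m)"
        by (simp add: c cinner_scale_right)
      then have "c = 0" using that o by (simp add: orthonormal_def)
      with c eigenvector_nonzero[OF o, of n] show False by simp
    qed
    then show "inj (($) ((1 / Z) *\<^sub>R w))"
      using Z \<open>k * T > 0\<close> by (intro injI) (auto simp: w_def)
  qed
qed


section \<open>Channels\<close>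

lemma linear_cscaleI:
  assumes "\<And>X Y. E (X + Y) = E X + E Y" "\<And>c X. E (cscale c X) = cscale c (E X)"
  shows "Vector_Spaces.linear cscale cscale E"
  using assms by (simp add: Vector_Spaces.linear_iff vector_space_cscale)

lemma channelD:
  assumes "channel E"
  shows "E (X + Y) = E X + E Y" "E (cscale c X) = cscale c (E X)" "completely_positive E"
    "trace (E X) = trace X"
  using assms by (simp_all add: channel_def Vector_Spaces.linear_iff)

lemma sum_in_nonneg_Reals:
  fixes f :: "'i \<Rightarrow> complex"
  assumes "\<And>i. i \<in> I \<Longrightarrow> f i \<in> \<real>\<^sub>\<ge>\<^sub>0"
  shows "(\<Sum>i\<in>I. f i) \<in> \<real>\<^sub>\<ge>\<^sub>0"
  using assms by (induction I rule: infinite_finite_induct) (auto intro: nonneg_Reals_add_I)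

lemma completely_positiveI:
  fixes E :: "complex^'n^'n \<Rightarrow> complex^'m^'m"
  assumes "\<And>k (X :: nat \<Rightarrow> nat \<Rightarrow> complex^'n^'n) v.
    (\<And>w. (\<Sum>i<k. \<Sum>j<k. cinner (w i) (X i j *v w j)) \<in> \<real>\<^sub>\<ge>\<^sub>0) \<Longrightarrow>
    (\<Sum>i<k. \<Sum>j<k. cinner (v i) (E (X i j) *v v j)) \<in> \<real>\<^sub>\<ge>\<^sub>0"
  shows "completely_positive E"
  unfolding completely_positive_def block_psd_def
proof (intro allI impI)
  fix k v and X :: "nat \<Rightarrow> nat \<Rightarrow> complex^'n^'n"
  assume *: "\<forall>w. (\<Sum>i<k. \<Sum>j<k. cinner (w i) (X i j *v w j)) \<in> \<real>\<^sub>\<ge>\<^sub>0"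
  show "(\<Sum>i<k. \<Sum>j<k. cinner (v i) (E (X i j) *v v j)) \<in> \<real>\<^sub>\<ge>\<^sub>0"
    by (rule assms) (rule *[rule_format])
qed

lemma completely_positiveD:
  fixes k :: nat
  assumes "completely_positive E"
    and "\<And>w. (\<Sum>i<k. \<Sum>j<k. cinner (w i) (X i j *v w j)) \<in> \<real>\<^sub>\<ge>\<^sub>0"
  shows "(\<Sum>i<k. \<Sum>j<k. cinner (v i) (E (X i j) *v v j)) \<in> \<real>\<^sub>\<ge>\<^sub>0"
proof -
  have "block_psd k X"
    using assms(2) by (simp add: block_psd_def)
  with assms(1) have "block_psd k (\<lambda>i j. E (X i j))"
    by (simp add: completely_positive_def)
  then show ?thesis
    by (simp add: block_psd_def)
qed

text \<open>In each block \<open>V\<close> moves onto the test vectors as \<open>adj V\<close>, so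
  the form of the image at \<open>v\<close> is the form of the original block matrix at the vectors
  \<open>adj V *v v i\<close>.\<close>

lemma completely_positive_conj_by: "completely_positive (conj_by V)"
  by (rule completely_positiveI) (simp only: cinner_conj_by)

lemma completely_positive_sum:
  assumes "\<And>i. i \<in> I \<Longrightarrow> completely_positive (E i)"
  shows "completely_positive (\<lambda>X. \<Sum>i\<in>I. E i X)"
proof (rule completely_positiveI, goal_cases)
  case (1 k X v)
  have "(\<Sum>n\<in>I. \<Sum>i<k. \<Sum>j<k. cinner (v i) (E n (X i j) *v v j)) \<in> \<real>\<^sub>\<ge>\<^sub>0"
    by (rule sum_in_nonneg_Reals) (rule completely_positiveD[OF assms 1])
  also have "(\<Sum>n\<in>I. \<Sum>i<k. \<Sum>j<k. cinner (v i) (E n (X i j) *v v j)) =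
      (\<Sum>i<k. \<Sum>j<k. cinner (v i) ((\<Sum>n\<in>I. E n (X i j)) *v v j))"
    unfolding matrix_sum_vector_mult cinner_sum_right
    by (rule trans[OF sum.swap], rule sum.cong[OF refl], rule sum.swap)
  finally show ?case .
qed

lemma channel_conj_by:
  assumes "adj V ** V = mat 1"
  shows "channel (conj_by V)"
  using assms unfolding channel_def
  by (auto intro!: linear_cscaleI simp: conj_by_add conj_by_cscale completely_positive_conj_by trace_conj_by)

text \<open>The output state is given in factored form because the columns of \<open>K\<close>
  directly yield Kraus operators; for a spectral state, \<open>spectral_factor\<close> supplies
  \<open>K\<close> as a square root.\<close>

lemma channel_replace:
  assumes "trace (K ** adj K) = 1"
  shows "channel (\<lambda>X. cscale (trace X) (K ** adj K))"
proof -
  \<comment> \<open>Kraus operators \<open>|K e\<^sub>n\<rangle>\<langle>e\<^sub>m|\<close>\<close>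
  let ?K = "\<lambda>m n. (\<chi> i p. if p = m then K $ i $ n else 0)"
  have eq: "(\<Sum>m\<in>UNIV. \<Sum>n\<in>UNIV. conj_by (?K m n) X) = cscale (trace X) (K ** adj K)" for X
  proof -
    have "conj_by (?K m n) X $ i $ j = K $ i $ n * X $ m $ m * cnj (K $ j $ n)" for m n i j
      by (rule conj_by_monomial)
    then show ?thesis
      by (simp add: vec_eq_iff matrix_mult_nth trace_def sum_product mult_ac)
  qed
  have "completely_positive (\<lambda>X. cscale (trace X) (K ** adj K))"
    unfolding eq[symmetric] by (intro completely_positive_sum completely_positive_conj_by)
  moreover have "Vector_Spaces.linear cscale cscale (\<lambda>X. cscale (trace X) (K ** adj K))"
    by (rule linear_cscaleI) (simp_all add: vec_eq_iff trace_add algebra_simps)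
  ultimately show ?thesis
    using assms by (simp add: channel_def)
qed

lemma channel_convex:
  assumes E: "channel E" and F: "channel F" and r: "0 \<le> r" "r \<le> 1"
  shows "channel (\<lambda>X. (1 - r) *\<^sub>R E X + r *\<^sub>R F X)"
proof -
  have "Vector_Spaces.linear cscale cscale (\<lambda>X. (1 - r) *\<^sub>R E X + r *\<^sub>R F X)"
    by (intro linear_cscaleI) (simp_all add: channelD[OF E] channelD[OF F] vec_eq_iff algebra_simps)
  moreover have "trace ((1 - r) *\<^sub>R E X + r *\<^sub>R F X) = trace X" for X
    by (simp add: channelD[OF E] channelD[OF F] trace_add trace_scaleR flip: distrib_right)
  moreover have "completely_positive (\<lambda>X. (1 - r) *\<^sub>R E X + r *\<^sub>R F X)"
  proof (rule completely_positiveI, goal_cases)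
    case (1 k X v)
    let ?S = "\<lambda>E. \<Sum>i<k. \<Sum>j<k. cinner (v i) (E (X i j) *v v j)"
    have "?S E \<in> \<real>\<^sub>\<ge>\<^sub>0" "?S F \<in> \<real>\<^sub>\<ge>\<^sub>0"
      by (rule completely_positiveD[OF channelD(3)[OF E] 1], rule completely_positiveD[OF channelD(3)[OF F] 1])
    then have "of_real (1 - r) * ?S E + of_real r * ?S F \<in> \<real>\<^sub>\<ge>\<^sub>0"
      using r by (intro nonneg_Reals_add_I nonneg_Reals_mult_I) (auto simp: complex_nonneg_Reals_iff)
    also have "of_real (1 - r) * ?S E + of_real r * ?S F =
        (\<Sum>i<k. \<Sum>j<k. cinner (v i) (((1 - r) *\<^sub>R E (X i j) + r *\<^sub>R F (X i j)) *v v j))"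
      unfolding matrix_vector_mult_add_rdistrib cinner_add_right matrix_scaleR_vector_mult cinner_scale_right
      by (simp add: sum.distrib sum_distrib_left)
    finally show ?case .
  qed
  ultimately show ?thesis
    by (simp add: channel_def)
qed

text \<open>Conjugating a matrix unit gives the product of a column of the operator with a
  conjugated column. Hence both sides are the same fourfold sum up to the order of
  summation.\<close>

lemma map_tensor_conj_by: "map_tensor (conj_by V) (conj_by W) X = conj_by (kron V W) X"
proof -
  have unit: "conj_by A (mat_unit m n) $ i $ j = A $ i $ m * cnj (A $ j $ n)" for A :: "complex^'k^'l" and m n i j
  proof -
    have "conj_by A (mat_unit m n) $ i $ j =
        (\<Sum>p\<in>UNIV. \<Sum>q\<in>UNIV. if p = m then if q = n then A $ i $ p * cnj (A $ j $ q) else 0 else 0)"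
      unfolding conj_by_nth by (intro sum.cong refl) (auto simp: mat_unit_def)
    also have "\<dots> = (\<Sum>p\<in>UNIV. if p = m then
        \<Sum>q\<in>UNIV. if q = n then A $ i $ p * cnj (A $ j $ q) else 0 else 0)"
      by (intro sum.cong refl) auto
    finally show ?thesis by simp
  qed
  have "map_tensor (conj_by V) (conj_by W) X $ p $ q = conj_by (kron V W) X $ p $ q" for p q
  proof -
    have "map_tensor (conj_by V) (conj_by W) X $ p $ q =
        (\<Sum>i\<in>UNIV. \<Sum>j\<in>UNIV. \<Sum>k\<in>UNIV. \<Sum>l\<in>UNIV. kron V W $ p $ (i, k) * X $ (i, k) $ (j, l) *
          cnj (kron V W $ q $ (j, l)))"
      by (simp add: map_tensor_def unit mult_ac)
    also have "\<dots> = conj_by (kron V W) X $ p $ q"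
      unfolding conj_by_nth sum_UNIV_prod by (rule sum.cong[OF refl], rule sum.swap)
    finally show ?thesis .
  qed
  then show ?thesis by (simp add: vec_eq_iff)
qed

lemma trace_mat_unit: "trace (mat_unit i j) = (if i = j then 1 else 0)"
  by (cases "i = j") (auto simp: trace_def mat_unit_def intro: sum.neutral)

text \<open>Only diagonal matrix units have nonzero trace, so the fourfold sum collapses to the
  diagonal of \<open>X\<close>.\<close>

lemma map_tensor_replace:
  "map_tensor (\<lambda>X. cscale (trace X) A) (\<lambda>X. cscale (trace X) B) X = cscale (trace X) (kron A B)"
proof -
  have "map_tensor (\<lambda>X. cscale (trace X) A) (\<lambda>X. cscale (trace X) B) X $ p $ q =
      (\<Sum>i\<in>UNIV. \<Sum>j\<in>UNIV. \<Sum>k\<in>UNIV. \<Sum>l\<in>UNIV. if i = j then if k = l then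
        X $ (i, k) $ (j, l) * (kron A B $ p $ q) else 0 else 0)" for p q
    unfolding map_tensor_def by (simp, intro sum.cong refl) (auto simp: trace_mat_unit)
  also have "\<dots> p q = (\<Sum>i\<in>UNIV. \<Sum>j\<in>UNIV. if i = j then \<Sum>k\<in>UNIV. \<Sum>l\<in>UNIV. if k = l then
        X $ (i, k) $ (j, l) * (kron A B $ p $ q) else 0 else 0)" for p q
    by (intro sum.cong refl) auto
  finally show ?thesis
    by (simp add: vec_eq_iff trace_def sum_UNIV_prod sum_distrib_right)
qed

section \<open>Haar integrals over the unitary group\<close>

lemma normalized_haarD:
  assumes "normalized_haar \<mu>"
  shows "prob_space \<mu>" "sets \<mu> = sets (restrict_space borel unitary_group)" "space \<mu> = unitary_group"
  using assms sets_eq_imp_space_eq[of \<mu> "restrict_space borel unitary_group"]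
  by (auto simp: normalized_haar_def space_restrict_space)

lemma continuous_on_matrix_mult [continuous_intros]:
  fixes f :: "'x::topological_space \<Rightarrow> complex^'n::finite^'m::finite"
    and g :: "'x \<Rightarrow> complex^'k::finite^'n"
  shows "continuous_on S f \<Longrightarrow> continuous_on S g \<Longrightarrow> continuous_on S (\<lambda>x. f x ** g x)"
  unfolding matrix_matrix_mult_def by (intro continuous_intros)

lemma continuous_on_map_matrix_cnj [continuous_intros]:
  fixes f :: "'x::topological_space \<Rightarrow> complex^'n::finite^'m::finite"
  shows "continuous_on S f \<Longrightarrow> continuous_on S (\<lambda>x. map_matrix cnj (f x))"
  unfolding map_matrix_def by (intro continuous_intros)

lemma continuous_on_adj [continuous_intros]:
  fixes f :: "'x::topological_space \<Rightarrow> complex^'n::finite^'m::finite"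
  shows "continuous_on S f \<Longrightarrow> continuous_on S (\<lambda>x. adj (f x))"
  unfolding adj_def map_matrix_def transpose_def by (simp, intro continuous_intros)

lemma continuous_on_kron [continuous_intros]:
  fixes f :: "'x::topological_space \<Rightarrow> complex^'n::finite^'n" and g :: "'x \<Rightarrow> complex^'m::finite^'m"
  shows "continuous_on S f \<Longrightarrow> continuous_on S g \<Longrightarrow> continuous_on S (\<lambda>x. kron (f x) (g x))"
  unfolding kron_def by (intro continuous_intros)

text \<open>Closed, being defined by continuous equations; bounded, because the columns of a unitary
  are unit vectors and so no entry exceeds 1 in modulus. Compactness makes every continuous
  integrand bounded.\<close>

lemma compact_unitary_group: "compact (unitary_group :: (complex^'n::finite^'n) set)"
proof -
  have "closed (unitary_group :: (complex^'n^'n) set)"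
    unfolding unitary_group_def Collect_conj_eq
    by (intro closed_Int closed_Collect_eq continuous_intros)
  moreover have "bounded (unitary_group :: (complex^'n^'n) set)"
  proof (rule boundedI)
    fix U :: "complex^'n^'n" assume "U \<in> unitary_group"
    then have U: "adj U ** U = mat 1" by (simp add: unitary_group_def)
    have entry: "norm (U $ i $ j) \<le> 1" for i j
    proof -
      have "(\<Sum>k\<in>UNIV. complex_of_real ((norm (U $ k $ j))\<^sup>2)) = 1"
        using isometry_nth[OF U, of j j] by (simp only: complex_norm_square) simp
      then have "(\<Sum>k\<in>UNIV. (norm (U $ k $ j))\<^sup>2) = 1"
        by (metis of_real_sum of_real_eq_1_iff)
      moreover have "(norm (U $ i $ j))\<^sup>2 \<le> (\<Sum>k\<in>UNIV. (norm (U $ k $ j))\<^sup>2)"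
        by (rule member_le_sum) auto
      ultimately show ?thesis
        by (simp add: abs_square_le_1)
    qed
    have "norm U \<le> (\<Sum>i\<in>UNIV. norm (U $ i))"
      by (simp add: norm_vec_def L2_set_le_sum)
    also have "\<dots> \<le> (\<Sum>i\<in>(UNIV::'n set). \<Sum>j\<in>(UNIV::'n set). 1)"
    proof (rule sum_mono)
      fix i
      have "norm (U $ i) \<le> (\<Sum>j\<in>UNIV. norm (U $ i $ j))"
        by (simp add: norm_vec_def L2_set_le_sum)
      also have "\<dots> \<le> (\<Sum>j\<in>(UNIV::'n set). 1)"
        by (rule sum_mono) (rule entry)
      finally show "norm (U $ i) \<le> (\<Sum>j\<in>(UNIV::'n set). 1)" .
    qed
    finally show "norm U \<le> (\<Sum>i\<in>(UNIV::'n set). \<Sum>j\<in>(UNIV::'n set). 1)" .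
  qed
  ultimately show ?thesis
    by (simp add: compact_eq_bounded_closed)
qed

lemma haar_measurable:
  fixes f :: "complex^'n::finite^'n \<Rightarrow> 'b::topological_space"
  assumes "normalized_haar \<mu>" "continuous_on unitary_group f"
  shows "f \<in> borel_measurable \<mu>"
  using borel_measurable_continuous_on_restrict[OF assms(2)] normalized_haarD(2)[OF assms(1)]
  by (simp cong: measurable_cong_sets)

lemma continuous_on_unitary_bounded:
  fixes f :: "complex^'n::finite^'n \<Rightarrow> 'b::real_normed_vector"
  assumes "continuous_on unitary_group f"
  obtains B where "\<And>U. U \<in> unitary_group \<Longrightarrow> norm (f U) \<le> B"
  using compact_imp_bounded[OF compact_continuous_image[OF assms compact_unitary_group]]
  by (auto simp: bounded_iff)

lemma haar_integrable:
  fixes f :: "complex^'n::finite^'n \<Rightarrow> 'b::{banach, second_countable_topology}"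
  assumes \<mu>: "normalized_haar \<mu>" and f: "continuous_on unitary_group f"
  shows "integrable \<mu> f"
proof -
  interpret prob_space \<mu> by (rule normalized_haarD(1)[OF \<mu>])
  from f obtain B where "\<And>U. U \<in> unitary_group \<Longrightarrow> norm (f U) \<le> B"
    using continuous_on_unitary_bounded by blast
  then show ?thesis
    using haar_measurable[OF \<mu> f] normalized_haarD(3)[OF \<mu>]
    by (intro integrable_const_bound[where B = B]) auto
qed

lemma unitary_group_mult: "V \<in> unitary_group \<Longrightarrow> U \<in> unitary_group \<Longrightarrow> V ** U \<in> unitary_group"
proof (rule unitary_groupI)
  assume "V \<in> unitary_group" "U \<in> unitary_group"
  then have V: "adj V ** V = mat 1" and U: "adj U ** U = mat 1"
    by (auto simp: unitary_group_def)
  have "adj (V ** U) ** (V ** U) = adj U ** (adj V ** V) ** U"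
    by (simp add: adj_mult matrix_mul_assoc)
  then show "adj (V ** U) ** (V ** U) = mat 1"
    by (simp add: V U)
qed

lemma unitary_group_adj: "U \<in> unitary_group \<Longrightarrow> adj U \<in> unitary_group"
  by (simp add: unitary_group_def)

lemma haar_invariant:
  fixes f :: "complex^'n::finite^'n \<Rightarrow> 'b::{banach, second_countable_topology}"
  assumes \<mu>: "normalized_haar \<mu>" and f: "continuous_on unitary_group f" and V: "V \<in> unitary_group"
  shows "(\<integral>U. f (V ** U) \<partial>\<mu>) = (\<integral>U. f U \<partial>\<mu>)"
proof -
  \<comment> \<open>The change of variables needs translation to be measurable into the Borel sets
    restricted to the group, hence the check that it maps the group to itself.\<close>
  have "(\<lambda>U. V ** U) \<in> measurable \<mu> (restrict_space borel unitary_group)"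
    using unitary_group_mult[OF V] normalized_haarD(3)[OF \<mu>]
    by (intro measurable_restrict_space2 haar_measurable[OF \<mu>] continuous_intros) auto
  then have "(\<lambda>U. V ** U) \<in> measurable \<mu> \<mu>"
    using normalized_haarD(2)[OF \<mu>] by (simp cong: measurable_cong_sets)
  then have "(\<integral>U. f (V ** U) \<partial>\<mu>) = (\<integral>U. f U \<partial>distr \<mu> \<mu> (\<lambda>U. V ** U))"
    by (rule integral_distr[OF _ haar_measurable[OF \<mu> f], symmetric])
  then show ?thesis
    using \<mu> V by (simp add: normalized_haar_def)
qed

text \<open>Schur's lemma for the defining representation: sign changes of a single basis vector kill the
  off-diagonal entries, and transpositions of two basis vectors equate the diagonal ones.\<close>
lemma unitary_invariant_scalar:
  fixes Z :: "complex^'n::finite^'n"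
  assumes inv: "\<And>V. V \<in> unitary_group \<Longrightarrow> conj_by V Z = Z"
  shows "Z = cscale (trace Z / of_nat CARD('n)) (mat 1)"
proof -
  \<comment> \<open>Permutation matrices with phases are unitary: they conjugate the identity to
    itself.\<close>
  have unitary: "(\<chi> i p. if p = f i then c i else 0) \<in> unitary_group" (is "?V \<in> _")
    if "inj f" "\<And>i. c i * cnj (c i) = 1" for f :: "'n \<Rightarrow> 'n" and c
  proof -
    have "conj_by ?V (mat 1) = mat 1"
      using that by (auto simp: vec_eq_iff conj_by_monomial mat_nth inj_eq)
    then show ?thesis
      using matrix_left_right_inverse by (auto simp: unitary_group_def conj_by_def)
  qed
  have off: "Z $ m $ n = 0" if "m \<noteq> n" for m n
  proof -
    let ?c = "\<lambda>i. if i = m then - 1 else 1"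
    \<comment> \<open>The sign sits on \<open>m\<close> but not on \<open>n\<close>, so invariance
      makes the entry equal to its own negative.\<close>
    have "?c m * Z $ m $ n * cnj (?c n) = Z $ m $ n"
      using arg_cong[where f = "\<lambda>Z. Z $ m $ n", OF inv[OF unitary[of "\<lambda>i. i" ?c]]]
      unfolding conj_by_monomial by simp
    then show ?thesis
      using that by simp
  qed
  have diag: "Z $ m $ m = Z $ n $ n" for m n
    using arg_cong[where f = "\<lambda>Z. Z $ n $ n", OF inv[OF unitary[of "Transposition.transpose n m" "\<lambda>_. 1"]]]
    unfolding conj_by_monomial by simp
  have "trace Z = of_nat CARD('n) * Z $ m $ m" for m
    unfolding trace_def using diag[of _ m] by (simp add: sum.cong[of UNIV UNIV "\<lambda>i. Z $ i $ i" "\<lambda>_. Z $ m $ m"])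
  then have "Z $ m $ m = trace Z / of_nat CARD('n)" for m
    by (simp add: field_simps)
  then show ?thesis
    using off by (auto simp: vec_eq_iff mat_nth)
qed

section \<open>The twirling channel\<close>

text \<open>The representation of the unitary group whose average is the twirl; the conjugate on the
  second factor is taken in the energy eigenbasis \<open>b\<close>.\<close>

definition twirl_op ::
  "('n::finite \<Rightarrow> complex^'n) \<Rightarrow> ('n \<Rightarrow> complex^'n) \<Rightarrow> complex^'n^'n \<Rightarrow> complex^('n \<times> 'n)^('n \<times> 'n)" where
  "twirl_op a b U = kron (op_of_matrix a U) (op_of_matrix b (map_matrix cnj U))"

lemma twirl_eq: "twirl \<mu> a b X = (\<integral>U. conj_by (twirl_op a b U) X \<partial>\<mu>)"
  by (simp add: twirl_def Let_def conj_by_def twirl_op_def)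

lemma continuous_on_op_of_matrix [continuous_intros]:
  fixes f :: "'x::topological_space \<Rightarrow> complex^'n::finite^'n"
  shows "continuous_on S f \<Longrightarrow> continuous_on S (\<lambda>x. op_of_matrix e (f x))"
  unfolding op_of_matrix_eq by (intro continuous_intros)

lemma continuous_on_twirl_integrand:
  "continuous_on S (\<lambda>U. conj_by (twirl_op a b U) X)"
  unfolding conj_by_def twirl_op_def by (intro continuous_intros)

lemma op_of_matrix_mult:
  assumes "orthonormal e"
  shows "op_of_matrix e (V ** U) = op_of_matrix e V ** op_of_matrix e U"
proof -
  let ?S = "basis_matrix e"
  have S: "adj ?S ** ?S = mat 1"
    using basis_matrix_unitary[OF assms] by (simp add: unitary_group_def)
  have "op_of_matrix e V ** op_of_matrix e U = ?S ** V ** (adj ?S ** ?S) ** U ** adj ?S"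
    by (simp add: op_of_matrix_eq matrix_mul_assoc)
  also have "\<dots> = op_of_matrix e (V ** U)"
    by (simp add: S op_of_matrix_eq matrix_mul_assoc)
  finally show ?thesis by simp
qed

lemma op_of_matrix_unitary:
  assumes "orthonormal e" "U \<in> unitary_group"
  shows "op_of_matrix e U \<in> unitary_group"
  unfolding op_of_matrix_eq
  by (intro unitary_group_mult unitary_group_adj basis_matrix_unitary assms)

text \<open>A change of basis permutes the unitary group. Invariance under all operators
  \<open>op_of_matrix e U\<close> is thus invariance under all unitaries, as Schur's lemma
  requires.\<close>

lemma op_of_matrix_surj:
  assumes "orthonormal e" "V \<in> unitary_group"
  obtains U where "U \<in> unitary_group" "op_of_matrix e U = V"
proof
  let ?S = "basis_matrix e"
  note S = basis_matrix_unitary[OF assms(1)]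
  show "adj ?S ** V ** ?S \<in> unitary_group"
    by (intro unitary_group_mult unitary_group_adj S assms)
  have "op_of_matrix e (adj ?S ** V ** ?S) = (?S ** adj ?S) ** V ** (?S ** adj ?S)"
    by (simp add: op_of_matrix_eq matrix_mul_assoc)
  then show "op_of_matrix e (adj ?S ** V ** ?S) = V"
    using S by (simp add: unitary_group_def)
qed

lemma map_matrix_cnj_mult: "map_matrix cnj (A ** B) = map_matrix cnj A ** map_matrix cnj B"
  by (simp add: vec_eq_iff map_matrix_def matrix_mult_nth)

lemma map_matrix_cnj_cnj: "map_matrix cnj (map_matrix cnj A) = A"
  by (simp add: vec_eq_iff map_matrix_def)

lemma map_matrix_cnj_unitary:
  assumes "U \<in> unitary_group"
  shows "map_matrix cnj U \<in> unitary_group"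
proof (rule unitary_groupI)
  have "adj (map_matrix cnj U) ** map_matrix cnj U = map_matrix cnj (adj U ** U)"
    by (simp add: vec_eq_iff map_matrix_def matrix_mult_nth)
  also have "\<dots> = mat 1"
    using assms by (auto simp: unitary_group_def vec_eq_iff map_matrix_def mat_nth)
  finally show "adj (map_matrix cnj U) ** map_matrix cnj U = mat 1" .
qed

lemma kron_unitary:
  assumes "V \<in> unitary_group" "W \<in> unitary_group"
  shows "kron V W \<in> unitary_group"
  using assms by (intro unitary_groupI) (simp add: adj_kron kron_mult unitary_group_def)

lemma twirl_op_unitary:
  assumes "orthonormal a" "orthonormal b" "U \<in> unitary_group"
  shows "twirl_op a b U \<in> unitary_group"
  unfolding twirl_op_def
  by (intro kron_unitary op_of_matrix_unitary map_matrix_cnj_unitary assms)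

lemma twirl_op_mult:
  assumes "orthonormal a" "orthonormal b"
  shows "twirl_op a b (V ** U) = twirl_op a b V ** twirl_op a b U"
  by (simp add: twirl_op_def kron_mult map_matrix_cnj_mult op_of_matrix_mult assms)

text \<open>Conjugation is bounded linear and passes under the integral, where the representation
  property merges \<open>V\<close> with \<open>U\<close>; left invariance of the Haar measure then
  absorbs \<open>V\<close>.\<close>

lemma conj_by_twirl:
  assumes \<mu>: "normalized_haar \<mu>" and ab: "orthonormal a" "orthonormal b" and V: "V \<in> unitary_group"
  shows "conj_by (twirl_op a b V) (twirl \<mu> a b X) = twirl \<mu> a b X"
proof -
  have "conj_by (twirl_op a b V) (twirl \<mu> a b X) =
      (\<integral>U. conj_by (twirl_op a b V) (conj_by (twirl_op a b U) X) \<partial>\<mu>)"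
    unfolding twirl_eq
    by (intro integral_bounded_linear[symmetric] bounded_linear_conj_by haar_integrable[OF \<mu>]
        continuous_on_twirl_integrand)
  also have "\<dots> = (\<integral>U. conj_by (twirl_op a b (V ** U)) X \<partial>\<mu>)"
    by (simp add: conj_by_conj_by twirl_op_mult[OF ab])
  also have "\<dots> = twirl \<mu> a b X"
    unfolding twirl_eq by (rule haar_invariant[OF \<mu> continuous_on_twirl_integrand V])
  finally show ?thesis .
qed

text \<open>Each integrand is conjugation by a unitary, hence a channel. The trace, scalar
  multiplication and the matrix elements are bounded linear, so they commute with the integral and
  the channel properties survive averaging.\<close>

lemma channel_twirl:
  fixes \<mu> :: "(complex^'n::finite^'n) measure"
  assumes \<mu>: "normalized_haar \<mu>" and ab: "orthonormal a" "orthonormal b"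
  shows "channel (twirl \<mu> a b)"
proof -
  note int = haar_integrable[OF \<mu> continuous_on_twirl_integrand, of a b]
  interpret prob_space \<mu> by (rule normalized_haarD(1)[OF \<mu>])
  have bl_cscale: "bounded_linear (cscale c :: complex^('n \<times> 'n)^('n \<times> 'n) \<Rightarrow> _)" for c
    by (intro linear_conv_bounded_linear[THEN iffD1] linearI) (simp_all add: vec_eq_iff algebra_simps)
  have bl_trace: "bounded_linear (trace :: complex^('n \<times> 'n)^('n \<times> 'n) \<Rightarrow> _)"
    by (intro linear_conv_bounded_linear[THEN iffD1] linearI)
       (simp_all add: trace_add trace_scaleR, simp add: scaleR_conv_of_real)
  have bl_cinner: "bounded_linear (\<lambda>X :: complex^('n \<times> 'n)^('n \<times> 'n). cinner v (X *v w))" for v w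
    by (intro linear_conv_bounded_linear[THEN iffD1] linearI)
       (simp_all add: matrix_vector_mult_add_rdistrib cinner_add_right matrix_scaleR_vector_mult
          cinner_scale_right, simp add: scaleR_conv_of_real)
  have U: "adj (twirl_op a b U) ** twirl_op a b U = mat 1" if "U \<in> space \<mu>" for U
    using twirl_op_unitary[OF ab] that normalized_haarD(3)[OF \<mu>] by (auto simp: unitary_group_def)
  have "Vector_Spaces.linear cscale cscale (twirl \<mu> a b)"
    unfolding twirl_eq
  proof (rule linear_cscaleI)
    show "(\<integral>U. conj_by (twirl_op a b U) (X + Y) \<partial>\<mu>) =
        (\<integral>U. conj_by (twirl_op a b U) X \<partial>\<mu>) + (\<integral>U. conj_by (twirl_op a b U) Y \<partial>\<mu>)" for X Y
      unfolding conj_by_add by (intro Bochner_Integration.integral_add int)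
    show "(\<integral>U. conj_by (twirl_op a b U) (cscale c X) \<partial>\<mu>) =
        cscale c (\<integral>U. conj_by (twirl_op a b U) X \<partial>\<mu>)" for c X
      unfolding conj_by_cscale by (intro integral_bounded_linear bl_cscale int)
  qed
  moreover have "trace (twirl \<mu> a b X) = trace X" for X
  proof -
    have "trace (twirl \<mu> a b X) = (\<integral>U. trace (conj_by (twirl_op a b U) X) \<partial>\<mu>)"
      unfolding twirl_eq by (intro integral_bounded_linear[symmetric] bl_trace int)
    also have "\<dots> = (\<integral>U. trace X \<partial>\<mu>)"
      by (intro Bochner_Integration.integral_cong refl trace_conj_by U)
    finally show ?thesis by (simp add: prob_space)
  qed
  moreover have "completely_positive (twirl \<mu> a b)"
  proof (rule completely_positiveI, goal_cases)
    case (1 k X v)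
    let ?S = "\<lambda>U. \<Sum>i<k. \<Sum>j<k. cinner (v i) (conj_by (twirl_op a b U) (X i j) *v v j)"
    have pos: "?S U \<in> \<real>\<^sub>\<ge>\<^sub>0" for U
      by (rule completely_positiveD[OF completely_positive_conj_by 1])
    have int_c: "integrable \<mu> (\<lambda>U. cinner (v i) (conj_by (twirl_op a b U) (X i j) *v v j))" for i j
      by (rule integrable_bounded_linear[OF bl_cinner int])
    have "(\<Sum>i<k. \<Sum>j<k. cinner (v i) (twirl \<mu> a b (X i j) *v v j)) = (\<integral>U. ?S U \<partial>\<mu>)"
      by (simp add: twirl_eq integral_bounded_linear[OF bl_cinner int, symmetric] int_c)
    \<comment> \<open>Nonnegativity of a complex integral is read off its real and imaginary
      parts.\<close>
    also have "(\<integral>U. ?S U \<partial>\<mu>) \<in> \<real>\<^sub>\<ge>\<^sub>0"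
    proof -
      have "integrable \<mu> ?S" by (intro Bochner_Integration.integrable_sum int_c)
      then have "Re (\<integral>U. ?S U \<partial>\<mu>) = (\<integral>U. Re (?S U) \<partial>\<mu>)" "Im (\<integral>U. ?S U \<partial>\<mu>) = (\<integral>U. Im (?S U) \<partial>\<mu>)"
        by (simp_all only: integral_bounded_linear[OF bounded_linear_Re] integral_bounded_linear[OF bounded_linear_Im])
      moreover have "Re (?S U) \<ge> 0" "Im (?S U) = 0" for U
        using pos[of U] by (auto simp only: complex_nonneg_Reals_iff)
      ultimately show ?thesis
        unfolding complex_nonneg_Reals_iff by (simp only: Bochner_Integration.integral_nonneg) simp
    qed
    finally show ?case .
  qed
  ultimately show ?thesis
    by (simp add: channel_def)
qed

text \<open>The twirled operator is invariant under every \<open>twirl_op a b U\<close>. Tracing out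
  the second system removes the conjugate factor, and the remaining factor ranges over all
  unitaries, so the marginal is scalar.\<close>

lemma ptrace_B_twirl:
  fixes \<mu> :: "(complex^'n::finite^'n) measure"
  assumes \<mu>: "normalized_haar \<mu>" and ab: "orthonormal a" "orthonormal b"
  shows "ptrace_B (twirl \<mu> a b X) = cscale (trace X / of_nat CARD('n)) (mat 1)"
proof -
  have "conj_by V (ptrace_B (twirl \<mu> a b X)) = ptrace_B (twirl \<mu> a b X)"
    if V: "V \<in> unitary_group" for V
  proof -
    obtain U where U: "U \<in> unitary_group" "op_of_matrix a U = V"
      using op_of_matrix_surj[OF ab(1) V] .
    have "adj (op_of_matrix b (map_matrix cnj U)) ** op_of_matrix b (map_matrix cnj U) = mat 1"
      using op_of_matrix_unitary[OF ab(2) map_matrix_cnj_unitary[OF U(1)]]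
      by (simp add: unitary_group_def)
    then have "conj_by V (ptrace_B (twirl \<mu> a b X)) = ptrace_B (conj_by (twirl_op a b U) (twirl \<mu> a b X))"
      by (simp add: ptrace_B_conj_by twirl_op_def U(2))
    then show ?thesis
      by (simp add: conj_by_twirl[OF \<mu> ab U(1)])
  qed
  from unitary_invariant_scalar[OF this] show ?thesis
    using channel_twirl[OF \<mu> ab] by (simp add: trace_ptrace_B channel_def)
qed

lemma ptrace_A_twirl:
  fixes \<mu> :: "(complex^'n::finite^'n) measure"
  assumes \<mu>: "normalized_haar \<mu>" and ab: "orthonormal a" "orthonormal b"
  shows "ptrace_A (twirl \<mu> a b X) = cscale (trace X / of_nat CARD('n)) (mat 1)"
proof -
  have "conj_by V (ptrace_A (twirl \<mu> a b X)) = ptrace_A (twirl \<mu> a b X)"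
    if V: "V \<in> unitary_group" for V
  proof -
    obtain W where W: "W \<in> unitary_group" "op_of_matrix b W = V"
      using op_of_matrix_surj[OF ab(2) V] .
    \<comment> \<open>The second tensor factor carries the conjugate of the group element, so the
      element itself is chosen as the conjugate of \<open>W\<close>.\<close>
    let ?U = "map_matrix cnj W"
    have U: "?U \<in> unitary_group" "op_of_matrix b (map_matrix cnj ?U) = V"
      using W by (simp_all add: map_matrix_cnj_unitary map_matrix_cnj_cnj)
    have "adj (op_of_matrix a ?U) ** op_of_matrix a ?U = mat 1"
      using op_of_matrix_unitary[OF ab(1) U(1)] by (simp add: unitary_group_def)
    then have "conj_by V (ptrace_A (twirl \<mu> a b X)) = ptrace_A (conj_by (twirl_op a b ?U) (twirl \<mu> a b X))"
      by (simp add: ptrace_A_conj_by twirl_op_def U(2))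
    then show ?thesis
      by (simp add: conj_by_twirl[OF \<mu> ab U(1)])
  qed
  from unitary_invariant_scalar[OF this] show ?thesis
    using channel_twirl[OF \<mu> ab] by (simp add: trace_ptrace_A channel_def)
qed


section \<open>Detecting entanglement\<close>

lemma quadratic_form_expand:
  "cinner (a *s u + c *s w) (A *v (a *s u + c *s w)) =
    cnj a * a * cinner u (A *v u) + cnj a * c * cinner u (A *v w) +
    cnj c * a * cinner w (A *v u) + cnj c * c * cinner w (A *v w)"
  by (simp add: matrix_vector_right_distrib vec.scale cinner_add_left cinner_add_right
      cinner_scale_left cinner_scale_right algebra_simps)

text \<open>Polarization: reality of the form at \<open>u + w\<close> makes the imaginary parts
  opposite, and reality at \<open>u + \<i> w\<close> makes the real parts equal.\<close>

lemma psd_hermitian: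
  assumes "psd A"
  shows "cinner w (A *v u) = cnj (cinner u (A *v w))"
proof -
  have real: "Im (cinner v (A *v v)) = 0" for v
    using assms by (auto simp: psd_def complex_nonneg_Reals_iff)
  show ?thesis
    using real[of "1 *s u + 1 *s w"] real[of "1 *s u + \<i> *s w"] real[of u] real[of w]
    unfolding quadratic_form_expand by (simp add: complex_eq_iff)
qed

lemma psd_cauchy_schwarz:
  assumes "psd A"
  shows "(cmod (cinner u (A *v w)))\<^sup>2 \<le> Re (cinner u (A *v u)) * Re (cinner w (A *v w))"
proof -
  let ?r = "cinner u (A *v w)"
  define p q where "p = Re (cinner u (A *v u))" and "q = Re (cinner w (A *v w))"
  have diag: "cinner u (A *v u) = of_real p" "cinner w (A *v w) = of_real q" "p \<ge> 0" "q \<ge> 0"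
    using assms by (auto simp: psd_def complex_nonneg_Reals_iff p_def q_def complex_eq_iff)
  define s where "s = (cmod ?r)\<^sup>2"
  have s: "cnj ?r * ?r = of_real s"
    by (subst mult.commute) (simp only: s_def complex_norm_square)
  \<comment> \<open>The classical discriminant argument: positivity at the vector
    \<open>x u - cnj r w\<close> is a real quadratic inequality in \<open>x\<close>, the phase of
    \<open>r\<close> having been absorbed by the coefficient of \<open>w\<close>.\<close>
  have nonneg: "0 \<le> x\<^sup>2 * p - 2 * x * s + s * q" for x
  proof -
    let ?v = "of_real x *s u + (- cnj ?r) *s w"
    have "cinner ?v (A *v ?v) = of_real x * of_real x * of_real p - of_real x * (cnj ?r * ?r)
        - of_real x * (cnj ?r * ?r) + (cnj ?r * ?r) * of_real q"
      unfolding quadratic_form_expand psd_hermitian[OF assms, of w u] diag(1,2)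
      by (simp add: algebra_simps)
    also have "\<dots> = of_real (x\<^sup>2 * p - 2 * x * s + s * q)"
      unfolding s by (simp add: power2_eq_square)
    finally have v: "cinner ?v (A *v ?v) = of_real (x\<^sup>2 * p - 2 * x * s + s * q)" .
    have "cinner ?v (A *v ?v) \<in> \<real>\<^sub>\<ge>\<^sub>0"
      using assms unfolding psd_def ..
    then show ?thesis
      unfolding v by (simp only: complex_nonneg_Reals_iff Re_complex_of_real)
  qed
  have "s \<le> p * q"
  proof (cases "s = 0")
    case True then show ?thesis using diag by simp
  next
    case False
    then have "s > 0" by (simp add: s_def)
    show ?thesis
    proof (cases "p = 0")
      case True
      \<comment> \<open>For \<open>p = 0\<close> the quadratic degenerates: \<open>x = q\<close>
        gives \<open>- s * q >= 0\<close>, so \<open>q = 0\<close>, and then \<open>x = 1\<close>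
        gives \<open>- 2 * s >= 0\<close>, against \<open>s > 0\<close>.\<close>
      with nonneg[of "q"] \<open>s > 0\<close> have "q \<le> 0" by (simp add: algebra_simps mult_le_0_iff)
      with nonneg[of 1] \<open>s > 0\<close> True diag show ?thesis by simp
    next
      case False
      with diag have "p > 0" by simp
      \<comment> \<open>The value \<open>x = s / p\<close> is the minimizer of the
        quadratic.\<close>
      then have "0 \<le> s * (q - s / p)"
        using nonneg[of "s / p"] by (simp add: power2_eq_square algebra_simps)
      then have "s / p \<le> q"
        using \<open>s > 0\<close> by (simp add: zero_le_mult_iff)
      then show ?thesis
        using \<open>p > 0\<close> by (simp add: divide_le_eq mult.commute)
    qed
  qed
  then show ?thesis by (simp add: s_def p_def q_def)
qed

text \<open>The inequality of arithmetic and geometric means in squared form: the square of a sum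
  exceeds four times the product by the square of the difference.\<close>

lemma two_mult_le_sum_squares:
  fixes P Q r x y :: real
  assumes "P \<ge> 0" "Q \<ge> 0" "r\<^sup>2 \<le> P * Q"
  shows "2 * x * y * r \<le> x\<^sup>2 * P + y\<^sup>2 * Q"
proof -
  have "(2 * x * y * r)\<^sup>2 = 4 * (x * y)\<^sup>2 * r\<^sup>2"
    by (simp add: power_mult_distrib)
  also have "\<dots> \<le> 4 * (x * y)\<^sup>2 * (P * Q)"
    using assms by (intro mult_left_mono) auto
  also have "\<dots> \<le> (x\<^sup>2 * P + y\<^sup>2 * Q)\<^sup>2"
    using zero_le_power2[of "x\<^sup>2 * P - y\<^sup>2 * Q"] by (simp add: power2_eq_square algebra_simps)
  finally show ?thesis
    by (rule power2_le_imp_le) (use assms in simp)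
qed

text \<open>The partial transpose of a separable state is positive on the span of
  \<open>u \<otimes> v'\<close> and \<open>u' \<otimes> v\<close>, stated without mentioning partial transposes.\<close>
lemma separable_witness:
  fixes \<rho> :: "complex^('a::finite \<times> 'b::finite)^('a \<times> 'b)" and u u' :: "complex^'a" and v v' :: "complex^'b"
  assumes "separable \<rho>"
  shows "2 * x * y * Re (cinner (vkron u v) (\<rho> *v vkron u' v')) \<le>
    x\<^sup>2 * Re (cinner (vkron u v') (\<rho> *v vkron u v')) + y\<^sup>2 * Re (cinner (vkron u' v) (\<rho> *v vkron u' v))"
proof -
  let ?f = "\<lambda>\<rho>. 2 * x * y * Re (cinner (vkron u v) (\<rho> *v vkron u' v')) -
    (x\<^sup>2 * Re (cinner (vkron u v') (\<rho> *v vkron u v')) + y\<^sup>2 * Re (cinner (vkron u' v) (\<rho> *v vkron u' v)))"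
  \<comment> \<open>The defect is real-linear in the operator, so the inequality cuts out a
    half-space and needs to be checked only on product states.\<close>
  have "convex {\<rho>. ?f \<rho> \<le> 0}"
  proof (rule convexI)
    fix X Y :: "complex^('a \<times> 'b)^('a \<times> 'b)" and s t :: real
    assume XY: "X \<in> {\<rho>. ?f \<rho> \<le> 0}" "Y \<in> {\<rho>. ?f \<rho> \<le> 0}" and "0 \<le> s" "0 \<le> t"
    have "?f (s *\<^sub>R X + t *\<^sub>R Y) = s * ?f X + t * ?f Y"
      unfolding matrix_vector_mult_add_rdistrib cinner_add_right matrix_scaleR_vector_mult cinner_scale_right
      by (simp add: algebra_simps)
    moreover have "s * ?f X \<le> 0" "t * ?f Y \<le> 0"
      using XY \<open>0 \<le> s\<close> \<open>0 \<le> t\<close> by (simp_all add: mult_nonneg_nonpos)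
    ultimately show "s *\<^sub>R X + t *\<^sub>R Y \<in> {\<rho>. ?f \<rho> \<le> 0}"
      by simp
  qed
  moreover have "{kron \<sigma> \<tau> | \<sigma> \<tau>. density_op \<sigma> \<and> density_op \<tau>} \<subseteq> {\<rho>. ?f \<rho> \<le> 0}"
  proof clarify
    fix \<sigma> :: "complex^'a^'a" and \<tau> :: "complex^'b^'b" assume "density_op \<sigma>" "density_op \<tau>"
    then have psd: "psd \<sigma>" "psd \<tau>" by (auto simp: density_op_def)
    have nonneg: "Re (cinner w (\<sigma> *v w)) \<ge> 0" "Im (cinner w (\<sigma> *v w)) = 0" for w
      using psd(1) by (auto simp: psd_def complex_nonneg_Reals_iff)
    have nonneg': "Re (cinner w (\<tau> *v w)) \<ge> 0" "Im (cinner w (\<tau> *v w)) = 0" for w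
      using psd(2) by (auto simp: psd_def complex_nonneg_Reals_iff)
    let ?r = "Re (cinner u (\<sigma> *v u') * cinner v (\<tau> *v v'))"
    have "?r\<^sup>2 \<le> (cmod (cinner u (\<sigma> *v u') * cinner v (\<tau> *v v')))\<^sup>2"
      using abs_Re_le_cmod by (simp only: abs_le_square_iff[symmetric] abs_norm_cancel)
    also have "\<dots> = (cmod (cinner u (\<sigma> *v u')))\<^sup>2 * (cmod (cinner v (\<tau> *v v')))\<^sup>2"
      by (simp add: norm_mult power_mult_distrib)
    also have "\<dots> \<le> (Re (cinner u (\<sigma> *v u)) * Re (cinner u' (\<sigma> *v u'))) *
        (Re (cinner v (\<tau> *v v)) * Re (cinner v' (\<tau> *v v')))"
      by (intro mult_mono psd_cauchy_schwarz psd mult_nonneg_nonneg nonneg) auto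
    \<comment> \<open>On product states the four diagonal factors may be re-paired: Cauchy-Schwarz
      yields the pairs \<open>u, u'\<close> and \<open>v, v'\<close>, while the claim needs
      \<open>u, v'\<close> and \<open>u', v\<close>. This regrouping is the effect of the partial
      transpose.\<close>
    finally have "?r\<^sup>2 \<le> (Re (cinner u (\<sigma> *v u)) * Re (cinner v' (\<tau> *v v'))) *
        (Re (cinner u' (\<sigma> *v u')) * Re (cinner v (\<tau> *v v)))"
      by (simp add: mult_ac)
    then have "2 * x * y * ?r \<le> x\<^sup>2 * (Re (cinner u (\<sigma> *v u)) * Re (cinner v' (\<tau> *v v'))) +
        y\<^sup>2 * (Re (cinner u' (\<sigma> *v u')) * Re (cinner v (\<tau> *v v)))"
      by (intro two_mult_le_sum_squares mult_nonneg_nonneg nonneg nonneg')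
    then show "?f (kron \<sigma> \<tau>) \<le> 0"
      by (simp add: kron_vkron cinner_vkron nonneg nonneg')
  qed
  ultimately have "convex hull {kron \<sigma> \<tau> | \<sigma> \<tau>. density_op \<sigma> \<and> density_op \<tau>} \<subseteq> {\<rho>. ?f \<rho> \<le> 0}"
    by (rule hull_minimal[rotated])
  then show ?thesis
    using assms by (auto simp: separable_def)
qed

section \<open>The maximally entangled state and its invariance under the twirl\<close>

definition max_entangled :: "('n::finite \<Rightarrow> complex^'n) \<Rightarrow> ('n \<Rightarrow> complex^'n) \<Rightarrow> complex^('n \<times> 'n)^('n \<times> 'n)" where
  "max_entangled a b = (1 / real CARD('n)) *\<^sub>R outer (\<Sum>n\<in>UNIV. vkron (a n) (b n))"

lemma cinner_max_entangled:
  assumes "orthonormal a" "orthonormal b"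
  shows "cinner (vkron (a i) (b j)) (\<Sum>n\<in>UNIV. vkron (a n) (b n)) = (if i = j then 1 else 0)"
proof -
  have "cinner (vkron (a i) (b j)) (\<Sum>n\<in>UNIV. vkron (a n) (b n)) =
      (\<Sum>n\<in>UNIV. if i = n then (if j = n then 1 else 0) else 0)"
    unfolding cinner_sum_right cinner_vkron
    by (intro sum.cong refl) (simp add: orthonormalD[OF assms(1)] orthonormalD[OF assms(2)])
  then show ?thesis by auto
qed

lemma cinner_max_entangled_vkron:
  fixes a b :: "'n::finite \<Rightarrow> complex^'n"
  assumes "orthonormal a" "orthonormal b"
  shows "cinner (vkron (a i) (b j)) (max_entangled a b *v vkron (a k) (b l)) =
    (if i = j \<and> k = l then 1 / of_nat CARD('n) else 0)"
proof -
  let ?\<phi> = "\<Sum>n\<in>UNIV. vkron (a n) (b n)"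
  have "cinner ?\<phi> (vkron (a k) (b l)) = (if k = l then 1 else 0)"
    using arg_cong[where f = cnj, OF cinner_max_entangled[OF assms, of k l]] by (simp only: cnj_cinner) simp
  then show ?thesis
    by (simp add: max_entangled_def matrix_scaleR_vector_mult outer_mult_vec cinner_scale_right
        cinner_max_entangled[OF assms])
qed

lemma density_op_max_entangled:
  fixes a b :: "'n::finite \<Rightarrow> complex^'n"
  assumes "orthonormal a" "orthonormal b"
  shows "density_op (max_entangled a b)"
  unfolding density_op_def
proof
  let ?\<phi> = "\<Sum>n\<in>UNIV. vkron (a n) (b n)"
  show "psd (max_entangled a b)"
    unfolding psd_def
  proof
    fix v
    have "cinner v (max_entangled a b *v v) = of_real ((cmod (cinner ?\<phi> v))\<^sup>2 / real CARD('n))"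
      unfolding max_entangled_def matrix_scaleR_vector_mult outer_mult_vec cinner_scale_right
      by (simp add: complex_norm_square cnj_cinner del: of_real_power)
    then show "cinner v (max_entangled a b *v v) \<in> \<real>\<^sub>\<ge>\<^sub>0"
      by (simp add: complex_nonneg_Reals_iff)
  qed
  have "cinner ?\<phi> ?\<phi> = of_nat CARD('n)"
    by (subst cinner_sum_left) (simp add: cinner_max_entangled[OF assms])
  then show "trace (max_entangled a b) = 1"
    by (simp add: max_entangled_def trace_scaleR trace_outer)
qed

text \<open>The image of the sum of the \<open>a n\<close> tensor \<open>b n\<close> has the
  \<open>(m, l)\<close> entry of \<open>U ** adj U\<close> as its coefficient at \<open>a m\<close>
  tensor \<open>b l\<close>; unitarity makes this the identity matrix.\<close>

lemma twirl_op_max_entangled: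
  fixes a b :: "'n::finite \<Rightarrow> complex^'n"
  assumes "orthonormal a" "orthonormal b" "U \<in> unitary_group"
  shows "conj_by (twirl_op a b U) (max_entangled a b) = max_entangled a b"
proof -
  have U: "(\<Sum>n\<in>UNIV. U $ m $ n * cnj (U $ l $ n)) = (if m = l then 1 else 0)" for m l
  proof -
    have "(U ** adj U) $ m $ l = mat 1 $ m $ l"
      using assms(3) by (simp add: unitary_group_def)
    then show ?thesis by (simp add: matrix_mult_nth mat_nth)
  qed
  have "twirl_op a b U *v (\<Sum>n\<in>UNIV. vkron (a n) (b n)) =
      (\<Sum>n\<in>UNIV. \<Sum>m\<in>UNIV. \<Sum>l\<in>UNIV. (U $ m $ n * cnj (U $ l $ n)) *s vkron (a m) (b l))"
    by (simp add: twirl_op_def vec.sum kron_vkron op_of_matrix_mult_vec assms vkron_sum_left vkron_sum_right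
        vkron_scale map_matrix_def)
       (rule sum.cong[OF refl], rule sum.swap)
  also have "\<dots> = (\<Sum>m\<in>UNIV. \<Sum>l\<in>UNIV. \<Sum>n\<in>UNIV. (U $ m $ n * cnj (U $ l $ n)) *s vkron (a m) (b l))"
    by (rule trans[OF sum.swap], rule sum.cong[OF refl], rule sum.swap)
  also have "\<dots> = (\<Sum>m\<in>UNIV. \<Sum>l\<in>UNIV. (if m = l then 1 else 0) *s vkron (a m) (b l))"
    unfolding vec.scale_sum_left[symmetric] U ..
  also have "\<dots> = (\<Sum>m\<in>UNIV. \<Sum>l\<in>UNIV. if m = l then vkron (a m) (b l) else 0)"
    by (intro sum.cong refl) auto
  also have "\<dots> = (\<Sum>n\<in>UNIV. vkron (a n) (b n))"
    by simp
  finally show ?thesis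
    by (simp add: max_entangled_def conj_by_scaleR conj_by_outer)
qed

lemma twirl_max_entangled:
  assumes \<mu>: "normalized_haar \<mu>" and ab: "orthonormal a" "orthonormal b"
  shows "twirl \<mu> a b (max_entangled a b) = max_entangled a b"
proof -
  interpret prob_space \<mu> by (rule normalized_haarD(1)[OF \<mu>])
  have "twirl \<mu> a b (max_entangled a b) = (\<integral>U. max_entangled a b \<partial>\<mu>)"
    unfolding twirl_eq
    by (intro Bochner_Integration.integral_cong refl twirl_op_max_entangled ab) (simp add: normalized_haarD(3)[OF \<mu>])
  then show ?thesis by (simp add: prob_space)
qed

section \<open>The thermalizing map\<close>

text \<open>For \<epsilon> below 1 this shows when \<open>eta\<close> is positive: \<epsilon>/d must
  not exceed any weight of the thermal state. At equality with a weight, the corresponding basis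
  vector is annihilated.\<close>

lemma eta_spectral:
  fixes p :: "real^'n::finite"
  assumes "orthonormal e" "\<epsilon> \<noteq> 1"
  shows "eta \<epsilon> (spectral e p) = spectral e (\<chi> n. (p $ n - \<epsilon> / real CARD('n)) / (1 - \<epsilon>))"
proof -
  interpret bounded_linear "spectral e" by (rule bounded_linear_spectral)
  have "eta \<epsilon> (spectral e p) =
      spectral e (p + (\<epsilon> / (1 - \<epsilon>)) *\<^sub>R (p - (1 / real CARD('n)) *\<^sub>R (\<chi> n. 1)))"
    by (simp add: eta_def spectral_1[OF assms(1), symmetric] add diff scaleR)
  also have "p + (\<epsilon> / (1 - \<epsilon>)) *\<^sub>R (p - (1 / real CARD('n)) *\<^sub>R (\<chi> n. 1)) =
      (\<chi> n. (p $ n - \<epsilon> / real CARD('n)) / (1 - \<epsilon>))"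
    using assms(2) by (simp add: vec_eq_iff divide_simps) (simp add: algebra_simps)
  finally show ?thesis .
qed

text \<open>The correction in \<open>eta\<close> compensates exactly for the maximally mixed
  marginal that the twirl contributes with weight \<epsilon>.\<close>

lemma eta_mixture:
  fixes \<gamma> :: "complex^'n::finite^'n"
  assumes "\<epsilon> \<noteq> 1"
  shows "(1 - \<epsilon>) *\<^sub>R eta \<epsilon> \<gamma> + \<epsilon> *\<^sub>R cscale (1 / of_nat CARD('n)) (mat 1) = \<gamma>"
proof -
  have "cscale (1 / of_nat CARD('n)) (mat 1) = (1 / real CARD('n)) *\<^sub>R (mat 1 :: complex^'n^'n)"
    by (simp add: vec_eq_iff) (simp add: scaleR_conv_of_real)
  then have "(1 - \<epsilon>) *\<^sub>R eta \<epsilon> \<gamma> + \<epsilon> *\<^sub>R cscale (1 / of_nat CARD('n)) (mat 1) =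
      (1 - \<epsilon>) *\<^sub>R \<gamma> + ((1 - \<epsilon>) * (\<epsilon> / (1 - \<epsilon>))) *\<^sub>R (\<gamma> - (1 / real CARD('n)) *\<^sub>R mat 1)
        + \<epsilon> *\<^sub>R (1 / real CARD('n)) *\<^sub>R mat 1"
    by (simp only: eta_def scaleR_add_right scaleR_scaleR)
  also have "(1 - \<epsilon>) * (\<epsilon> / (1 - \<epsilon>)) = \<epsilon>"
    using assms by simp
  also have "(1 - \<epsilon>) *\<^sub>R \<gamma> + \<epsilon> *\<^sub>R (\<gamma> - (1 / real CARD('n)) *\<^sub>R mat 1)
      + \<epsilon> *\<^sub>R (1 / real CARD('n)) *\<^sub>R mat 1 = \<gamma>"
    by (simp only: scaleR_diff_right scaleR_left_diff_distrib scaleR_one) simp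
  finally show ?thesis .
qed

lemma spectral_factor:
  assumes "orthonormal e" "\<And>n. x $ n \<ge> 0"
  shows "spectral e x = spectral e (\<chi> n. sqrt (x $ n)) ** adj (spectral e (\<chi> n. sqrt (x $ n)))"
  using assms(2) by (simp add: adj_spectral spectral_mult[OF assms(1)])

lemma channel_replace_spectral:
  assumes "orthonormal e" "\<And>n. x $ n \<ge> 0" "(\<Sum>n\<in>UNIV. x $ n) = 1"
  shows "channel (\<lambda>X. cscale (trace X) (spectral e x))"
proof -
  have "trace (spectral e x) = 1"
    by (simp only: trace_spectral[OF assms(1)] assms(3)) simp
  then show ?thesis
    unfolding spectral_factor[OF assms(1,2)] by (rule channel_replace)
qed

lemma channel_replace_kron_spectral:
  assumes "orthonormal a" "\<And>n. x $ n \<ge> 0" "(\<Sum>n\<in>UNIV. x $ n) = 1"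
    and "orthonormal b" "\<And>n. y $ n \<ge> 0" "(\<Sum>n\<in>UNIV. y $ n) = 1"
  shows "channel (\<lambda>X. cscale (trace X) (kron (spectral a x) (spectral b y)))"
proof -
  let ?K = "kron (spectral a (\<chi> n. sqrt (x $ n))) (spectral b (\<chi> n. sqrt (y $ n)))"
  have K: "kron (spectral a x) (spectral b y) = ?K ** adj ?K"
    by (simp only: adj_kron kron_mult spectral_factor[symmetric] assms)
  have "trace (kron (spectral a x) (spectral b y)) = 1"
    by (simp only: trace_kron trace_spectral[OF assms(1)] trace_spectral[OF assms(4)] assms(3,6)) simp
  then show ?thesis
    unfolding K by (rule channel_replace)
qed

lemma thermalizing_map_eq:
  "thermalizing_map \<mu> a b \<gamma>\<^sub>A \<gamma>\<^sub>B \<epsilon> X =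
    (1 - \<epsilon>) *\<^sub>R cscale (trace X) (kron (eta \<epsilon> \<gamma>\<^sub>A) (eta \<epsilon> \<gamma>\<^sub>B)) + \<epsilon> *\<^sub>R twirl \<mu> a b X"
  by (simp add: thermalizing_map_def vec_eq_iff)

text \<open>The shared variable is a coin of bias \<epsilon> together with an independent Haar
  unitary. On heads the parties apply their factors of the twirl, on tails each replaces the local
  state.\<close>

lemma losr_mixture_twirl:
  fixes \<mu> :: "(complex^'n::finite^'n) measure" and a b :: "'n \<Rightarrow> complex^'n"
  assumes \<mu>: "normalized_haar \<mu>" and ab: "orthonormal a" "orthonormal b"
    and \<epsilon>: "0 \<le> \<epsilon>" "\<epsilon> \<le> 1"
    and chan: "channel (\<lambda>X :: 'n op. cscale (trace X) A)" "channel (\<lambda>X :: 'n op. cscale (trace X) B)"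
  shows "losr_mixture (measure_pmf (bernoulli_pmf \<epsilon>) \<Otimes>\<^sub>M \<mu>)
    (\<lambda>(s, U). if s then conj_by (op_of_matrix a U) else (\<lambda>X. cscale (trace X) A))
    (\<lambda>(s, U). if s then conj_by (op_of_matrix b (map_matrix cnj U)) else (\<lambda>X. cscale (trace X) B))
    (\<lambda>X. (1 - \<epsilon>) *\<^sub>R cscale (trace X) (kron A B) + \<epsilon> *\<^sub>R twirl \<mu> a b X)"
    (is "losr_mixture ?M ?EA ?EB ?E")
proof -
  interpret \<mu>: prob_space \<mu> by (rule normalized_haarD(1)[OF \<mu>])
  interpret pair_prob_space "measure_pmf (bernoulli_pmf \<epsilon>)" \<mu> ..
  have unit: "adj (op_of_matrix a U) ** op_of_matrix a U = mat 1"
    "adj (op_of_matrix b (map_matrix cnj U)) ** op_of_matrix b (map_matrix cnj U) = mat 1"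
    if "U \<in> space \<mu>" for U
    using that op_of_matrix_unitary[OF ab(1), of U] op_of_matrix_unitary[OF ab(2) map_matrix_cnj_unitary, of U]
    by (auto simp: normalized_haarD(3)[OF \<mu>] unitary_group_def)
  have "has_bochner_integral ?M (\<lambda>l. map_tensor (?EA l) (?EB l) X) (?E X)" for X
  proof -
    define f where "f = (\<lambda>U. conj_by (twirl_op a b U) X)"
    define c where "c = cscale (trace X) (kron A B)"
    have f_cont: "continuous_on unitary_group f"
      unfolding f_def by (rule continuous_on_twirl_integrand)
    have [measurable]: "f \<in> borel_measurable \<mu>"
      by (rule haar_measurable[OF \<mu> f_cont])
    have eq: "map_tensor (?EA l) (?EB l) X = (if fst l then f (snd l) else c)" for l
      by (cases l) (simp add: f_def c_def map_tensor_conj_by map_tensor_replace twirl_op_def)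
    obtain K where K: "\<And>U. U \<in> unitary_group \<Longrightarrow> norm (f U) \<le> K"
      using continuous_on_unitary_bounded[OF f_cont] by blast
    have int: "integrable ?M (\<lambda>l. if fst l then f (snd l) else c)"
    proof (rule P.integrable_const_bound)
      show "AE l in ?M. norm (if fst l then f (snd l) else c) \<le> max K (norm c)"
        using K by (intro AE_I2) (auto simp: space_pair_measure normalized_haarD(3)[OF \<mu>] le_max_iff_disj)
    qed measurable
    \<comment> \<open>By Fubini the unitary is integrated first for a fixed coin value; the coin
      then contributes two terms weighted by \<epsilon> and 1 - \<epsilon>.\<close>
    have "(\<integral>l. (if fst l then f (snd l) else c) \<partial>?M) =
        (\<integral>s. (\<integral>U. (if s then f U else c) \<partial>\<mu>) \<partial>measure_pmf (bernoulli_pmf \<epsilon>))"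
      by (subst integral_fst'[OF int, symmetric]) (simp cong: if_cong)
    also have "\<dots> = ?E X"
      using \<epsilon> by (subst integral_measure_pmf[of UNIV])
        (auto simp: UNIV_bool \<mu>.prob_space f_def c_def twirl_eq add.commute)
    finally show ?thesis
      using int by (simp add: has_bochner_integral_iff eq)
  qed
  moreover have "channel (?EA l) \<and> channel (?EB l)" if "l \<in> space ?M" for l
    using that chan by (auto simp: space_pair_measure intro!: channel_conj_by unit)
  ultimately show ?thesis
    unfolding losr_mixture_def using P.prob_space_axioms by blast
qed

lemma not_separable_thermalizing_map:
  fixes \<mu> :: "(complex^'n::finite^'n) measure" and a b :: "'n \<Rightarrow> complex^'n"
  assumes \<mu>: "normalized_haar \<mu>" and ab: "orthonormal a" "orthonormal b"
    and \<epsilon>: "0 < \<epsilon>" and eta: "eta \<epsilon> \<gamma>\<^sub>A = spectral a x" "eta \<epsilon> \<gamma>\<^sub>B = spectral b y"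
    and zero: "x $ j = 0 \<or> y $ j = 0" and "i \<noteq> j"
  shows "\<not> separable (thermalizing_map \<mu> a b \<gamma>\<^sub>A \<gamma>\<^sub>B \<epsilon> (max_entangled a b))"
proof
  let ?\<rho> = "thermalizing_map \<mu> a b \<gamma>\<^sub>A \<gamma>\<^sub>B \<epsilon> (max_entangled a b)"
  assume sep: "separable ?\<rho>"
  have "trace (max_entangled a b) = 1"
    using density_op_max_entangled[OF ab] by (simp add: density_op_def)
  then have \<rho>: "?\<rho> = (1 - \<epsilon>) *\<^sub>R kron (spectral a x) (spectral b y) + \<epsilon> *\<^sub>R max_entangled a b"
    by (simp add: thermalizing_map_eq twirl_max_entangled[OF \<mu> ab] eta vec_eq_iff)
  have "cinner (vkron (a i) (b k)) (kron (spectral a x) (spectral b y) *v vkron (a l) (b m)) =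
      (if i = l \<and> k = m then of_real (x $ l * y $ m) else 0)" for i k l m
    by (simp add: kron_vkron spectral_mult_vec ab cinner_vkron cinner_scale_right orthonormalD)
  then have entry: "cinner (vkron (a i) (b k)) (?\<rho> *v vkron (a l) (b m)) =
      of_real (1 - \<epsilon>) * (if i = l \<and> k = m then of_real (x $ l * y $ m) else 0) +
      of_real \<epsilon> * (if i = k \<and> l = m then 1 / of_nat CARD('n) else 0)" for i k l m
    unfolding \<rho> matrix_vector_mult_add_rdistrib matrix_scaleR_vector_mult cinner_add_right cinner_scale_right
      cinner_max_entangled_vkron[OF ab] by simp
  define P Q r where "P = (1 - \<epsilon>) * (x $ i * y $ j)" and "Q = (1 - \<epsilon>) * (x $ j * y $ i)"
    and "r = \<epsilon> / real CARD('n)"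
  \<comment> \<open>The witness at \<open>a i, b i\<close> and \<open>a j, b j\<close>: the cross
    term sees only the entangled part, the two diagonal terms only the product part.\<close>
  have ineq: "2 * s * t * r \<le> s\<^sup>2 * P + t\<^sup>2 * Q" for s t
    using separable_witness[OF sep, of s t "a i" "b i" "a j" "b j"] \<open>i \<noteq> j\<close>
    unfolding entry by (simp add: P_def Q_def r_def)
  have "r > 0"
    using \<epsilon> by (simp add: r_def)
  from zero consider "P = 0" | "Q = 0"
    by (auto simp: P_def Q_def)
  then show False
  proof cases
    case 1
    \<comment> \<open>With \<open>P = 0\<close> the free coefficient is scaled so that the left side
      becomes \<open>2 * (Q + 1)\<close>, beyond the right side \<open>Q\<close>; the instance
      \<open>0, 1\<close> supplies \<open>Q >= 0\<close>. The other case is symmetric.\<close>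
    then show False
      using ineq[of "(Q + 1) / r" 1] \<open>r > 0\<close> ineq[of 0 1] by simp
  next
    case 2
    then show False
      using ineq[of 1 "(P + 1) / r"] \<open>r > 0\<close> ineq[of 1 0] by simp
  qed
qed

theorem theorem3:
  fixes H\<^sub>A H\<^sub>B \<gamma>\<^sub>A \<gamma>\<^sub>B :: "'n::{finite,linorder} op"
    and a b :: "'n \<Rightarrow> (complex, 'n) vec"
    and k T\<^sub>A T\<^sub>B P\<^sub>m\<^sub>i\<^sub>n \<epsilon> :: real
    and \<mu> :: "'n op measure"
  assumes "CARD('n) \<ge> 2"
    and "hermitian H\<^sub>A" and "hermitian H\<^sub>B"
    and "nondegenerate H\<^sub>A" and "nondegenerate H\<^sub>B"
    and "energy_eigenbasis H\<^sub>A a" and "energy_eigenbasis H\<^sub>B b"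
    and "k > 0" and "T\<^sub>A > 0" and "T\<^sub>B > 0"
    and "normalized_haar \<mu>"
    and "\<gamma>\<^sub>A = thermal_state k T\<^sub>A H\<^sub>A" and "\<gamma>\<^sub>B = thermal_state k T\<^sub>B H\<^sub>B"
    and "P\<^sub>m\<^sub>i\<^sub>n = Min (Re ` (eigenvalues \<gamma>\<^sub>A \<union> eigenvalues \<gamma>\<^sub>B))"
    and "\<epsilon> = real CARD('n) * P\<^sub>m\<^sub>i\<^sub>n"
  shows "EPLT \<gamma>\<^sub>A \<gamma>\<^sub>B (thermalizing_map \<mu> a b \<gamma>\<^sub>A \<gamma>\<^sub>B \<epsilon>)"
proof -
  note \<mu> = \<open>normalized_haar \<mu>\<close>
  have "k * T\<^sub>A > 0" "k * T\<^sub>B > 0"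
    using assms by auto
  obtain p where p: "\<gamma>\<^sub>A = spectral a p" "orthonormal a" "\<And>n. p $ n > 0" "(\<Sum>n\<in>UNIV. p $ n) = 1" "inj (($) p)"
    using thermal_state_spectral[OF \<open>energy_eigenbasis H\<^sub>A a\<close> \<open>nondegenerate H\<^sub>A\<close> \<open>k * T\<^sub>A > 0\<close>,
        folded \<open>\<gamma>\<^sub>A = thermal_state k T\<^sub>A H\<^sub>A\<close>] by blast
  obtain q where q: "\<gamma>\<^sub>B = spectral b q" "orthonormal b" "\<And>n. q $ n > 0" "(\<Sum>n\<in>UNIV. q $ n) = 1" "inj (($) q)"
    using thermal_state_spectral[OF \<open>energy_eigenbasis H\<^sub>B b\<close> \<open>nondegenerate H\<^sub>B\<close> \<open>k * T\<^sub>B > 0\<close>,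
        folded \<open>\<gamma>\<^sub>B = thermal_state k T\<^sub>B H\<^sub>B\<close>] by blast
  \<comment> \<open>The eigenvalues are real, so taking real parts returns exactly the
    weights.\<close>
  have Pmin: "P\<^sub>m\<^sub>i\<^sub>n = Min (range (($) p) \<union> range (($) q))"
    unfolding assms(14) p(1) q(1) eigenvalues_spectral[OF p(2)] eigenvalues_spectral[OF q(2)]
    by (simp add: image_Un image_image)
  have le: "P\<^sub>m\<^sub>i\<^sub>n \<le> p $ n" "P\<^sub>m\<^sub>i\<^sub>n \<le> q $ n" for n
    unfolding Pmin by (auto intro!: Min_le)
  have "P\<^sub>m\<^sub>i\<^sub>n \<in> range (($) p) \<union> range (($) q)"
    unfolding Pmin by (rule Min_in) auto
  \<comment> \<open>The level \<open>j\<close> attains the overall minimum in one of the two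
    systems; there the shifted weight vanishes, which breaks positivity of the partial
    transpose.\<close>
  then obtain j where j: "p $ j = P\<^sub>m\<^sub>i\<^sub>n \<or> q $ j = P\<^sub>m\<^sub>i\<^sub>n"
    by auto
  obtain i where "i \<noteq> j"
    using \<open>CARD('n) \<ge> 2\<close> by (metis (full_types) UNIV_eq_I card_1_singleton_iff insertI1 not_numeral_le_zero numeral_le_one_iff One_nat_def semiring_norm(69))
  have "\<epsilon> > 0"
    using j p(3) q(3) assms(15) by (metis mult_pos_pos of_nat_0_less_iff zero_less_card_finite)
  \<comment> \<open>The weights of \<open>p\<close> are pairwise distinct and \<open>d\<close> is at
    least 2, so some weight strictly exceeds the minimum; summing over all levels gives
    \<open>d\<close> times the minimum below 1.\<close>
  have "\<epsilon> < 1"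
  proof -
    have "P\<^sub>m\<^sub>i\<^sub>n < p $ i \<or> P\<^sub>m\<^sub>i\<^sub>n < p $ j"
      using le(1)[of i] le(1)[of j] injD[OF \<open>inj (($) p)\<close>, of i j] \<open>i \<noteq> j\<close> by linarith
    then have "(\<Sum>n\<in>(UNIV :: 'n set). P\<^sub>m\<^sub>i\<^sub>n) < (\<Sum>n\<in>UNIV. p $ n)"
      by (intro sum_strict_mono_ex1) (auto simp: le)
    then show ?thesis
      using p(4) assms(15) by simp
  qed
  have Pmin': "\<epsilon> / real CARD('n) = P\<^sub>m\<^sub>i\<^sub>n"
    using assms(15) by simp
  \<comment> \<open>The weights of the two \<open>eta\<close> states: nonnegative by minimality, and
    summing to 1 since \<epsilon> is \<open>d\<close> times the minimum.\<close>
  define x y :: "(real, 'n) vec" where "x = (\<chi> n. (p $ n - P\<^sub>m\<^sub>i\<^sub>n) / (1 - \<epsilon>))"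
    and "y = (\<chi> n. (q $ n - P\<^sub>m\<^sub>i\<^sub>n) / (1 - \<epsilon>))"
  have eta: "eta \<epsilon> \<gamma>\<^sub>A = spectral a x" "eta \<epsilon> \<gamma>\<^sub>B = spectral b y"
    using \<open>\<epsilon> < 1\<close> by (simp_all add: p(1) q(1) eta_spectral p(2) q(2) Pmin' x_def y_def)
  have nonneg: "x $ n \<ge> 0" "y $ n \<ge> 0" for n
    using le \<open>\<epsilon> < 1\<close> by (simp_all add: x_def y_def)
  have sum_1: "(\<Sum>n\<in>UNIV. x $ n) = 1" "(\<Sum>n\<in>UNIV. y $ n) = 1"
    using \<open>\<epsilon> < 1\<close> p(4) q(4)
    by (simp_all add: x_def y_def sum_subtractf assms(15)[symmetric] flip: sum_divide_distrib)
  note chan = channel_replace_spectral[OF p(2) nonneg(1) sum_1(1)] channel_replace_spectral[OF q(2) nonneg(2) sum_1(2)]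
  let ?E = "thermalizing_map \<mu> a b \<gamma>\<^sub>A \<gamma>\<^sub>B \<epsilon>"
  have E: "?E = (\<lambda>X. (1 - \<epsilon>) *\<^sub>R cscale (trace X) (kron (spectral a x) (spectral b y)) + \<epsilon> *\<^sub>R twirl \<mu> a b X)"
    by (simp add: fun_eq_iff thermalizing_map_eq eta)
  have "channel ?E"
    unfolding E using \<open>\<epsilon> > 0\<close> \<open>\<epsilon> < 1\<close>
    by (intro channel_convex channel_replace_kron_spectral channel_twirl \<mu> p(2) q(2) nonneg sum_1) auto
  moreover have "losr_mixture (measure_pmf (bernoulli_pmf \<epsilon>) \<Otimes>\<^sub>M \<mu>)
      (\<lambda>(s, U). if s then conj_by (op_of_matrix a U) else (\<lambda>X. cscale (trace X) (spectral a x)))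
      (\<lambda>(s, U). if s then conj_by (op_of_matrix b (map_matrix cnj U)) else (\<lambda>X. cscale (trace X) (spectral b y))) ?E"
    unfolding E using \<open>\<epsilon> > 0\<close> \<open>\<epsilon> < 1\<close>
    by (intro losr_mixture_twirl \<mu> p(2) q(2) chan) auto
  ultimately have "losr_channel ?E"
    by (rule losr_channelI)
  moreover have "ptrace_A (?E \<rho>) = \<gamma>\<^sub>B" "ptrace_B (?E \<rho>) = \<gamma>\<^sub>A" if "density_op \<rho>" for \<rho>
  proof -
    have tr: "trace \<rho> = 1" "trace (spectral a x) = 1" "trace (spectral b y) = 1"
      using that by (simp_all only: density_op_def trace_spectral p(2) q(2) sum_1 of_real_1)
    have one: "cscale 1 X = X" for X :: "complex^'m^'l"
      by (simp add: vec_eq_iff)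
    have "ptrace_A (?E \<rho>) = (1 - \<epsilon>) *\<^sub>R eta \<epsilon> \<gamma>\<^sub>B + \<epsilon> *\<^sub>R cscale (1 / of_nat CARD('n)) (mat 1)"
      by (simp add: thermalizing_map_eq ptrace_A_add ptrace_A_scaleR ptrace_A_kron eta tr one
          ptrace_A_twirl[OF \<mu> p(2) q(2)])
    then show "ptrace_A (?E \<rho>) = \<gamma>\<^sub>B"
      using \<open>\<epsilon> < 1\<close> by (simp add: eta_mixture)
    have "ptrace_B (?E \<rho>) = (1 - \<epsilon>) *\<^sub>R eta \<epsilon> \<gamma>\<^sub>A + \<epsilon> *\<^sub>R cscale (1 / of_nat CARD('n)) (mat 1)"
      by (simp add: thermalizing_map_eq ptrace_B_add ptrace_B_scaleR ptrace_B_kron eta tr one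
          ptrace_B_twirl[OF \<mu> p(2) q(2)])
    then show "ptrace_B (?E \<rho>) = \<gamma>\<^sub>A"
      using \<open>\<epsilon> < 1\<close> by (simp add: eta_mixture)
  qed
  moreover have "\<not> separable (?E (max_entangled a b))"
    using j \<open>\<epsilon> > 0\<close> \<open>\<epsilon> < 1\<close>
    by (intro not_separable_thermalizing_map[OF \<mu> p(2) q(2) _ eta _ \<open>i \<noteq> j\<close>]) (auto simp: x_def y_def)
  ultimately show ?thesis
    unfolding EPLT_def local_thermalization_def
    using density_op_max_entangled[OF p(2) q(2)] by blast
qed

end
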